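(* Let $X$ be a Banach space which contains a complemented isomorphic copy of $\ell^1$. Then there is a closed separable subspace $Y\subset X^*$ such that $$Y\subsetneqq\overline{Y}^{\sigma(X^*,B_1(X))}.$$ In particular, there is no locally convex topology $\tau$ on $X^*$ such that $\text{(I)-env}(A)=\overline{\operatorname{conv} A}^{\tau}$ for each $A\subset X^*$.
   Context: Banach spaces are real or complex. For a Banach space $X$ and $A\subset X^*$, the (I)-envelope of $A$ is $$\text{(I)-env}(A)= \bigcap\left\{\overline{\operatorname{conv}\bigcup_{n=1}^\infty \overline{\operatorname{conv} A_n}^{w^*}}^{\|\cdot\|} : A=\bigcup_{n=1}^\infty A_n\right\},$$ the intersection being over all countable covers $A=\bigcup_n A_n$ by subsets of $A$. Here $\operatorname{conv}$ is the convex hull. Further, $B_1(X)=\{x^{**}\in X^{**} : \text{there is a sequence } (x_n) \text{ in } X \text{ with } x_n\to x^{**} \text{ in the weak}^*\text{ topology of } X^{**}\}$. For a linear subspace $Z\subset X^{**}$, $\sigma(X^*,Z)$ is the weakest topology on $X^*$ making all elements of $Z$ continuous. $\overline{A}^{\tau}$ denotes the closure of $A$ in the topology $\tau$. "Closed" and "separable" for subspaces of $X^*$ refer to the norm topology. A locally convex topology is a vector space topology having a base of neighborhoods of zero consisting of convex sets. *)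

theory Defs
  imports "HOL-Analysis.Analysis"
begin

section \<open>Banach spaces over a real or complex scalar field\<close>

text \<open>
  The library's class \<open>banach\<close> only knows real Banach spaces.  To treat real and complex spaces
  at once, the scalars are a type \<open>'k\<close> of sort \<open>{real_normed_field, banach}\<close>; by Gelfand--Mazur
  such a field is isometrically isomorphic to \<open>real\<close> or to \<open>complex\<close>, and both of these are
  instances.  A Banach space over \<open>'k\<close> is a type \<open>'a :: banach\<close> with a multiplication by scalars
  in \<open>'k\<close> that extends the real one and for which the norm is homogeneous.
\<close>

locale banach_over = vector_space smul
  for smul :: "'k::{real_normed_field,banach} \<Rightarrow> 'a::banach \<Rightarrow> 'a" +
  assumes scale_of_real: "smul (of_real r) x = r *\<^sub>R x"
    and norm_scale: "norm (smul c x) = norm c * norm x"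

lemma banach_over_real: "banach_over ((*\<^sub>R) :: real \<Rightarrow> 'a::banach \<Rightarrow> 'a)"
  by unfold_locales (simp_all add: algebra_simps)

lemma banach_over_complex: "banach_over ((*) :: complex \<Rightarrow> complex \<Rightarrow> complex)"
  by unfold_locales (simp_all add: algebra_simps norm_mult scaleR_conv_of_real)

text \<open>
  The dual \<open>X\<^sup>*\<close> is a subset of the normed space \<open>'a \<Rightarrow>\<^sub>L 'k\<close> of bounded real-linear maps, with
  the operator norm of that type.  For real scalars it is the whole type.
\<close>

definition dual_space ::
    "('k::{real_normed_field,banach} \<Rightarrow> 'a::banach \<Rightarrow> 'a) \<Rightarrow> ('a \<Rightarrow>\<^sub>L 'k) set"
  where "dual_space smul =
    {f. \<forall>c x. blinfun_apply f (smul c x) = c * blinfun_apply f x}"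

lemma dual_space_real: "dual_space ((*\<^sub>R) :: real \<Rightarrow> 'a::banach \<Rightarrow> 'a) = UNIV"
  by (simp add: dual_space_def blinfun.scaleR_right)

definition dual_scale ::
    "'k::{real_normed_field,banach} \<Rightarrow> ('a::banach \<Rightarrow>\<^sub>L 'k) \<Rightarrow> ('a \<Rightarrow>\<^sub>L 'k)"
  where "dual_scale c f = blinfun_mult_right c o\<^sub>L f"

lemma dual_scale_apply [simp]: "blinfun_apply (dual_scale c f) x = c * blinfun_apply f x"
  by (simp add: dual_scale_def)

lemma vector_space_dual_scale: "vector_space dual_scale"
  by unfold_locales (auto intro!: blinfun_eqI simp: algebra_simps blinfun.add_left)

lemma subspace_dual_space: "module.subspace dual_scale (dual_space smul)"
  by (auto simp: module.subspace_def[OF vector_space_dual_scale[folded module_iff_vector_space]]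
      dual_space_def blinfun.add_left algebra_simps)

text \<open>
  The bidual \<open>X\<^sup>*\<^sup>*\<close>: bounded \<open>'k\<close>-linear functionals on \<open>dual_space smul\<close>.  As these are total
  functions on the larger type \<open>'a \<Rightarrow>\<^sub>L 'k\<close>, they are required to be \<open>undefined\<close> off the dual
  (\<open>extensional\<close>), so that equal functionals are equal functions.
\<close>

definition bidual_space ::
    "('k::{real_normed_field,banach} \<Rightarrow> 'a::banach \<Rightarrow> 'a) \<Rightarrow> (('a \<Rightarrow>\<^sub>L 'k) \<Rightarrow> 'k) set"
  where "bidual_space smul =
    {\<phi> \<in> extensional (dual_space smul).
      (\<forall>f\<in>dual_space smul. \<forall>g\<in>dual_space smul. \<phi> (f + g) = \<phi> f + \<phi> g) \<and>
      (\<forall>c. \<forall>f\<in>dual_space smul. \<phi> (dual_scale c f) = c * \<phi> f) \<and>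
      (\<exists>M. \<forall>f\<in>dual_space smul. norm (\<phi> f) \<le> M * norm f)}"

definition canonical_embedding ::
    "('k::{real_normed_field,banach} \<Rightarrow> 'a::banach \<Rightarrow> 'a) \<Rightarrow> 'a \<Rightarrow> ('a \<Rightarrow>\<^sub>L 'k) \<Rightarrow> 'k"
  where "canonical_embedding smul x =
    restrict (\<lambda>f. blinfun_apply f x) (dual_space smul)"


section \<open>Weak topologies\<close>

text \<open>The weakest topology on \<open>S\<close> making all functions in \<open>F\<close> continuous.\<close>

definition weak_topology :: "'s set \<Rightarrow> ('s \<Rightarrow> 'k::topological_space) set \<Rightarrow> 's topology"
  where "weak_topology S F =
    topology_generated_by (insert S {S \<inter> \<phi> -` U | \<phi> U. \<phi> \<in> F \<and> open U})"

lemma topspace_weak_topology [simp]: "topspace (weak_topology S F) = S"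
  by (auto simp: weak_topology_def)

lemma continuous_map_weak_topology:
  assumes "\<phi> \<in> F"
  shows "continuous_map (weak_topology S F) euclidean \<phi>"
proof -
  have "openin (weak_topology S F) (S \<inter> \<phi> -` U)" if "open U" for U
    unfolding weak_topology_def
    by (rule topology_generated_by_Basis) (use assms that in blast)
  then show ?thesis
    by (auto simp: continuous_map_alt Int_commute)
qed

lemma weak_topology_weakest:
  assumes "topspace T = S" and "\<And>\<phi>. \<phi> \<in> F \<Longrightarrow> continuous_map T euclidean \<phi>"
    and "openin (weak_topology S F) W"
  shows "openin T W"
proof -
  have *: "openin T V" if "V \<in> insert S {S \<inter> \<phi> -` U | \<phi> U. \<phi> \<in> F \<and> open U}" for V
    using that assms(1,2) by (auto simp: continuous_map_alt Int_commute)
  have "generate_topology_on (insert S {S \<inter> \<phi> -` U | \<phi> U. \<phi> \<in> F \<and> open U}) W"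
    using assms(3) by (simp add: weak_topology_def openin_topology_generated_by_iff)
  then show ?thesis
    by induction (use * in auto)
qed

definition weak_star_dual ::
    "('k::{real_normed_field,banach} \<Rightarrow> 'a::banach \<Rightarrow> 'a) \<Rightarrow> ('a \<Rightarrow>\<^sub>L 'k) topology"
  where "weak_star_dual smul =
    weak_topology (dual_space smul) (range (\<lambda>x f. blinfun_apply f x))"

definition weak_star_bidual ::
    "('k::{real_normed_field,banach} \<Rightarrow> 'a::banach \<Rightarrow> 'a) \<Rightarrow> (('a \<Rightarrow>\<^sub>L 'k) \<Rightarrow> 'k) topology"
  where "weak_star_bidual smul =
    weak_topology (bidual_space smul) ((\<lambda>f \<phi>. \<phi> f) ` dual_space smul)"

definition baire_one ::
    "('k::{real_normed_field,banach} \<Rightarrow> 'a::banach \<Rightarrow> 'a) \<Rightarrow> (('a \<Rightarrow>\<^sub>L 'k) \<Rightarrow> 'k) set"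
  where "baire_one smul =
    {\<phi> \<in> bidual_space smul. \<exists>x :: nat \<Rightarrow> 'a.
      limitin (weak_star_bidual smul) (\<lambda>n. canonical_embedding smul (x n)) \<phi> sequentially}"


section \<open>The (I)-envelope and locally convex topologies\<close>

text \<open>\<open>closure\<close> is the norm closure; \<open>dual_space smul\<close> is norm closed in \<open>'a \<Rightarrow>\<^sub>L 'k\<close>.\<close>

definition I_envelope ::
    "('k::{real_normed_field,banach} \<Rightarrow> 'a::banach \<Rightarrow> 'a) \<Rightarrow> ('a \<Rightarrow>\<^sub>L 'k) set \<Rightarrow> ('a \<Rightarrow>\<^sub>L 'k) set"
  where "I_envelope smul A =
    \<Inter> {closure (convex hull (\<Union>n. weak_star_dual smul closure_of (convex hull (B n)))) | B.
        A = (\<Union>n::nat. B n)}"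

text \<open>Locally convex topologies on \<open>X\<^sup>*\<close>; as usual for vector space topologies in this setting,
  no separation axiom is included.\<close>

definition locally_convex_topology_on_dual ::
    "('k::{real_normed_field,banach} \<Rightarrow> 'a::banach \<Rightarrow> 'a) \<Rightarrow> ('a \<Rightarrow>\<^sub>L 'k) topology \<Rightarrow> bool"
  where "locally_convex_topology_on_dual smul \<tau> \<longleftrightarrow>
    topspace \<tau> = dual_space smul \<and>
    continuous_map (prod_topology \<tau> \<tau>) \<tau> (\<lambda>(f, g). f + g) \<and>
    continuous_map (prod_topology euclidean \<tau>) \<tau> (\<lambda>(c, f). dual_scale c f) \<and>
    (\<forall>U. openin \<tau> U \<and> 0 \<in> U \<longrightarrow>
      (\<exists>V W. convex V \<and> openin \<tau> W \<and> 0 \<in> W \<and> W \<subseteq> V \<and> V \<subseteq> U))"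


section \<open>Complemented copies of \<open>\<ell>\<^sup>1\<close>\<close>

definition ell1 :: "(nat \<Rightarrow> 'k::{real_normed_field,banach}) set"
  where "ell1 = {a. summable (\<lambda>n. norm (a n))}"

definition ell1_norm :: "(nat \<Rightarrow> 'k::{real_normed_field,banach}) \<Rightarrow> real"
  where "ell1_norm a = (\<Sum>n. norm (a n))"

text \<open>\<open>J\<close> is a linear isomorphism of \<open>\<ell>\<^sup>1\<close> onto \<open>E\<close>, bounded with bounded inverse.\<close>

definition ell1_isomorphism_onto ::
    "('k::{real_normed_field,banach} \<Rightarrow> 'a::banach \<Rightarrow> 'a) \<Rightarrow> 'a set \<Rightarrow> ((nat \<Rightarrow> 'k) \<Rightarrow> 'a) \<Rightarrow> bool"
  where "ell1_isomorphism_onto smul E J \<longleftrightarrow>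
    bij_betw J ell1 E \<and>
    (\<forall>a\<in>ell1. \<forall>b\<in>ell1. J (\<lambda>n. a n + b n) = J a + J b) \<and>
    (\<forall>c. \<forall>a\<in>ell1. J (\<lambda>n. c * a n) = smul c (J a)) \<and>
    (\<exists>m>0. \<exists>M. \<forall>a\<in>ell1. m * ell1_norm a \<le> norm (J a) \<and> norm (J a) \<le> M * ell1_norm a)"

definition complemented_subspace ::
    "('k::{real_normed_field,banach} \<Rightarrow> 'a::banach \<Rightarrow> 'a) \<Rightarrow> 'a set \<Rightarrow> bool"
  where "complemented_subspace smul E \<longleftrightarrow>
    module.subspace smul E \<and> closed E \<and>
    (\<exists>P :: 'a \<Rightarrow>\<^sub>L 'a.
      (\<forall>c x. blinfun_apply P (smul c x) = smul c (blinfun_apply P x)) \<and>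
      range (blinfun_apply P) = E \<and> (\<forall>x\<in>E. blinfun_apply P x = x))"

definition contains_complemented_ell1 ::
    "('k::{real_normed_field,banach} \<Rightarrow> 'a::banach \<Rightarrow> 'a) \<Rightarrow> bool"
  where "contains_complemented_ell1 smul \<longleftrightarrow>
    (\<exists>E J. complemented_subspace smul E \<and> ell1_isomorphism_onto smul E J)"

end

theory Submission
  imports Defs
begin

text \<open>
  Composing the projection with the isomorphism gives a bounded surjection \<open>Q\<close> of \<open>X\<close> onto
  \<open>\<ell>\<^sup>1\<close>.  Its adjoint \<open>comb\<close> embeds \<open>\<ell>\<^sup>\<infinity>\<close> isomorphically into \<open>X\<^sup>*\<close>; \<open>Y\<close> is the image
  \<open>c0_copy\<close> of \<open>c\<^sub>0\<close>, and \<open>all_one\<close>, the image of the constant sequence 1, is the point outside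
  \<open>Y\<close> on which both assertions rest.

  An element of \<open>B\<^sub>1(X)\<close>, composed with the adjoint, is a weak-star limit of a sequence
  in \<open>\<ell>\<^sup>1\<close>; as \<open>\<ell>\<^sup>1\<close> is weakly sequentially complete, it is again an element of \<open>\<ell>\<^sup>1\<close>, so it maps
  the truncations \<open>(1, \<dots>, 1, 0, 0, \<dots>)\<close> to a sequence converging to its value at the constant
  sequence 1 (\<open>baire_one_head_tendsto\<close>).  Hence \<open>all_one\<close> is in the closure of \<open>Y\<close> for
  \<open>\<sigma>(X\<^sup>*, B\<^sub>1(X))\<close>.  That \<open>Y\<close> is separable presupposes separable scalars, which is where the
  Gelfand--Mazur theorem enters.

  Now let the (I)-envelope be the closed convex hull in a locally convex topology \<open>\<tau>\<close>.
  Covering a separable convex set by pieces of small diameter shows that its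
  (I)-envelope lies in its norm closure (\<open>I_envelope_subset_closure\<close>).  So \<open>Y\<close> is \<open>\<tau>\<close>-closed and
  \<open>all_one\<close> is not in \<open>Y + V\<close> for some convex \<open>\<tau>\<close>-neighbourhood \<open>V\<close> of 0.
  The Hahn--Banach theorem would now give a \<open>\<tau>\<close>-continuous functional that vanishes on \<open>Y\<close> and not at
  \<open>all_one\<close>.  A convex set \<open>C\<close> containing \<open>Y + V\<close> and maximal among those without \<open>all_one\<close> does the same
  service: its complement is convex too (\<open>maximal_convex_avoiding\<close>), and \<open>2 all_one\<close> is not in its
  \<open>\<tau>\<close>-closure.

  The contradiction is that \<open>2 all_one\<close> lies in the (I)-envelope of \<open>C \<inter> X\<^sup>*\<close>
  (\<open>twice_all_one_in_I_envelope\<close>).  The reason is a Baire category fact: \<open>C\<close> pulls back to a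
  nonmeagre subset of the ball of radius 3 of \<open>\<ell>\<^sup>\<infinity>\<close>, in the topology whose basic open sets are the
  cylinders, the sets of all sequences with a given prefix.  For a meagre set there is a sequence \<open>p\<close> and a division of the indices into blocks
  such that every sequence following \<open>p\<close> on infinitely many blocks is outside the set
  (\<open>block_pattern\<close>).  Let \<open>m\<close> sequences follow \<open>p\<close> on the blocks of one residue class modulo \<open>m\<close> each,
  and equal \<open>-3\<close> elsewhere: none is in \<open>C\<close>, hence neither is their average \<open>-3 all_one + v / m\<close>
  with \<open>v\<close> independent of \<open>m\<close>, nor, averaging again with \<open>all_one\<close>, the vector \<open>v / (4 m)\<close>.  But
  \<open>C\<close> contains a neighbourhood of 0.  So in every countable cover of \<open>C \<inter> X\<^sup>*\<close> the weak-star
  closed convex hull of some piece contains a whole cylinder of the ball, in particular a point of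
  \<open>3 all_one + Y\<close>, and a convex combination with a point of \<open>Y \<subseteq> C\<close> is \<open>2 all_one\<close>.
\<close>

section \<open>The Gelfand--Mazur theorem for real normed fields\<close>

text \<open>
  The square of the absolute value of \<open>u + z\<close> in the quadratic extension of the field by a square
  root of \<open>-1\<close>, defined as the norm of the product of \<open>u + z\<close> with its conjugate.  It
  is multiplicative whether or not \<open>-1\<close> is already a square in the field.
\<close>

definition quad_norm :: "'k::real_normed_field \<Rightarrow> complex \<Rightarrow> real"
  where "quad_norm u z = norm ((u + of_real (Re z))\<^sup>2 + of_real ((Im z)\<^sup>2))"

lemma quad_norm_nonneg: "0 \<le> quad_norm u z"
  by (simp add: quad_norm_def)

lemma quad_norm_square_minus:
  "quad_norm (u\<^sup>2) (- (s\<^sup>2)) = quad_norm u s * quad_norm u (- s)" for u :: "'k::real_normed_field"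
proof -
  have "(u\<^sup>2 + of_real (Re (- (s\<^sup>2))))\<^sup>2 + of_real ((Im (- (s\<^sup>2)))\<^sup>2)
      = ((u + of_real (Re s))\<^sup>2 + of_real ((Im s)\<^sup>2)) *
        ((u + of_real (Re (- s)))\<^sup>2 + of_real ((Im (- s))\<^sup>2))"
    by (simp add: power2_eq_square) algebra
  then show ?thesis
    by (simp only: quad_norm_def norm_mult)
qed

lemma quad_norm_of_real: "quad_norm u (of_real r) = (norm (u + of_real r))\<^sup>2"
  by (simp add: quad_norm_def norm_power)

lemma quad_norm_shift: "quad_norm (u + of_real r) z = quad_norm u (of_real r + z)"
  by (simp add: quad_norm_def add.assoc)

text \<open>
  Suppose that \<open>y + z\<close> is bounded away from 0 for complex \<open>z\<close> and that \<open>q = y\<^sup>2 + \<beta>\<close> attains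
  the bound \<open>m\<close>.  Over the complex numbers \<open>q\<^sup>n + c\<close> splits into \<open>2 n\<close> factors of the form \<open>y + z\<close>,
  so its norm is at least \<open>m\<^sup>n\<close>.  In \<open>q\<^sup>n - \<epsilon>\<^sup>n = (q + \<epsilon>) (q - \<epsilon>) (q\<^sup>2 + \<epsilon>\<^sup>2) (q\<^sup>4 + \<epsilon>\<^sup>4) \<dots>\<close>,
  with \<open>n\<close> a power of 2, the left side has norm at most \<open>m\<^sup>n + \<epsilon>\<^sup>n\<close>; bounding all factors except
  \<open>q + \<epsilon>\<close> from below leaves \<open>norm (q + \<epsilon>) \<le> m (1 + (\<epsilon>/m)\<^sup>n)\<close>, and \<open>n\<close> tends to infinity.
\<close>

lemma minimal_quad_norm_shift:
  fixes y :: "'k::real_normed_field"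
  assumes low: "\<And>z. m \<le> quad_norm y z" and "0 < m"
    and eq: "norm (y\<^sup>2 + of_real \<beta>) = m" and \<epsilon>: "0 \<le> \<epsilon>" "\<epsilon> < m"
  shows "norm (y\<^sup>2 + of_real (\<beta> + \<epsilon>)) = m"
proof -
  define q where "q = y\<^sup>2 + of_real \<beta>"
  have pow: "(m ^ 2 ^ j)\<^sup>2 \<le> quad_norm (q ^ 2 ^ j) c" for j c
  proof (induction j arbitrary: c)
    case 0
    define s where "s = csqrt (- (of_real \<beta> + c))"
    have "m * m \<le> quad_norm y s * quad_norm y (- s)"
      using low \<open>0 < m\<close> by (intro mult_mono) (auto simp: quad_norm_nonneg)
    also have "\<dots> = quad_norm (y\<^sup>2) (of_real \<beta> + c)"
      by (simp add: s_def add.commute flip: quad_norm_square_minus)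
    finally show ?case
      by (simp add: q_def quad_norm_shift power2_eq_square)
  next
    case (Suc j)
    define s where "s = csqrt (- c)"
    have "(m ^ 2 ^ j)\<^sup>2 * (m ^ 2 ^ j)\<^sup>2 \<le> quad_norm (q ^ 2 ^ j) s * quad_norm (q ^ 2 ^ j) (- s)"
      using Suc.IH \<open>0 < m\<close> by (intro mult_mono) (auto simp: quad_norm_nonneg)
    also have "\<dots> = quad_norm ((q ^ 2 ^ j)\<^sup>2) c"
      by (simp add: s_def flip: quad_norm_square_minus)
    finally show ?case
      by (simp add: power_mult[symmetric] power_add[symmetric] mult.commute
          flip: power2_eq_square)
  qed
  have low_real: "m ^ 2 ^ j \<le> norm (q ^ 2 ^ j + of_real r)" for j r
    using pow[of j "of_real r"] \<open>0 < m\<close>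
    by (simp only: quad_norm_of_real) (meson norm_ge_zero power2_le_imp_le)
  have tel: "norm (q + of_real \<epsilon>) * m ^ (2 ^ j) \<le> m * norm (q ^ 2 ^ j - of_real (\<epsilon> ^ 2 ^ j))"
    if "j > 0" for j
    using that
  proof (induction j rule: nat_induct_non_zero)
    case 1
    have "norm (q + of_real \<epsilon>) * m\<^sup>2 = m * (norm (q + of_real \<epsilon>) * m)"
      by (simp add: power2_eq_square)
    also have "\<dots> \<le> m * (norm (q + of_real \<epsilon>) * norm (q - of_real \<epsilon>))"
      using low_real[of 0 "-\<epsilon>"] \<open>0 < m\<close> by (intro mult_left_mono) auto
    also have "\<dots> = m * norm (q\<^sup>2 - of_real (\<epsilon>\<^sup>2))"
      by (simp add: norm_mult[symmetric] power2_eq_square algebra_simps)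
    finally show ?case
      by simp
  next
    case (Suc j)
    have "norm (q + of_real \<epsilon>) * m ^ (2 ^ Suc j) = (norm (q + of_real \<epsilon>) * m ^ (2 ^ j)) * m ^ 2 ^ j"
      by (simp add: power_mult power2_eq_square mult.commute[of 2])
    also have "\<dots> \<le> (m * norm (q ^ 2 ^ j - of_real (\<epsilon> ^ 2 ^ j))) * norm (q ^ 2 ^ j + of_real (\<epsilon> ^ 2 ^ j))"
      using low_real[of j "\<epsilon> ^ 2 ^ j"] \<open>0 < m\<close> by (intro mult_mono Suc.IH) auto
    also have "\<dots> = m * norm ((q ^ 2 ^ j)\<^sup>2 - (of_real (\<epsilon> ^ 2 ^ j))\<^sup>2)"
      by (simp add: norm_mult[symmetric] power2_eq_square algebra_simps)
    finally show ?case
      by (simp add: power_mult[symmetric] mult.commute)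
  qed
  have le: "norm (q + of_real \<epsilon>) \<le> m * (1 + (\<epsilon> / m) ^ (2 ^ Suc j))" for j
  proof -
    let ?n = "2 ^ Suc j :: nat"
    have "norm (q + of_real \<epsilon>) * m ^ ?n \<le> m * norm (q ^ ?n - of_real (\<epsilon> ^ ?n))"
      by (rule tel) simp
    also have "\<dots> \<le> m * (m ^ ?n + \<epsilon> ^ ?n)"
      using norm_triangle_ineq4[of "q ^ ?n" "of_real (\<epsilon> ^ ?n)"] eq \<open>0 < m\<close> \<epsilon>
      by (intro mult_left_mono) (auto simp: q_def norm_power)
    also have "\<dots> = m * (1 + (\<epsilon> / m) ^ ?n) * m ^ ?n"
      using \<open>0 < m\<close> by (simp add: power_divide field_simps)
    finally show ?thesis
      using \<open>0 < m\<close> by simp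
  qed
  have "(\<lambda>j. (\<epsilon> / m) ^ (2 ^ Suc j)) \<longlonglongrightarrow> 0"
  proof -
    have "strict_mono (\<lambda>j. 2 ^ Suc j :: nat)"
      by (intro strict_monoI) simp
    moreover have "(\<lambda>j. (\<epsilon> / m) ^ j) \<longlonglongrightarrow> 0"
      using \<epsilon> \<open>0 < m\<close> by (intro LIMSEQ_power_zero) auto
    ultimately have "((\<lambda>j. (\<epsilon> / m) ^ j) \<circ> (\<lambda>j. 2 ^ Suc j)) \<longlonglongrightarrow> 0"
      by (intro LIMSEQ_subseq_LIMSEQ)
    then show ?thesis
      by (simp only: o_def)
  qed
  then have "(\<lambda>j. m * (1 + (\<epsilon> / m) ^ (2 ^ Suc j))) \<longlonglongrightarrow> m * (1 + 0)"
    by (intro tendsto_intros)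
  then have "norm (q + of_real \<epsilon>) \<le> m"
    using le by (auto intro: LIMSEQ_le_const)
  moreover have "m \<le> norm (q + of_real \<epsilon>)"
    using low_real[of 0 \<epsilon>] by simp
  ultimately show ?thesis
    by (simp add: q_def add.assoc)
qed

text \<open>
  The continuous function \<open>z \<mapsto> quad_norm x (- z)\<close> grows at infinity and so attains its minimum.
  If the minimum were positive, shifting repeatedly by half of it would never change the norm of
  \<open>y\<^sup>2 + \<beta>\<close>, although the norm tends to infinity with \<open>\<beta>\<close>.
\<close>

lemma root_of_real_quadratic:
  fixes x :: "'k::real_normed_field"
  shows "\<exists>a b. (x - of_real a)\<^sup>2 = - of_real (b\<^sup>2)"
proof -
  have quad_norm_x: "quad_norm x (- z) = norm (x\<^sup>2 - of_real (2 * Re z) * x + of_real ((cmod z)\<^sup>2))" for z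
    unfolding quad_norm_def cmod_power2
    by (rule arg_cong[where f = norm]) (simp add: power2_eq_square algebra_simps)
  \<comment> \<open>Beyond modulus \<open>R + norm x\<close> the leading term \<open>(cmod z)\<^sup>2\<close> outweighs the others.\<close>
  define R where "R = 1 + 2 * norm x"
  have far: "quad_norm x 0 \<le> quad_norm x (- z)" if "R + norm x \<le> cmod z" for z
  proof -
    have "2 * (norm x)\<^sup>2 + 2 * cmod z * norm x \<le> (cmod z)\<^sup>2"
    proof -
      have "norm x * 3 \<le> cmod z"
        using that by (simp add: R_def)
      then have "(norm x * 3) * norm x \<le> cmod z * norm x" "cmod z * (norm x * 3) \<le> cmod z * cmod z"
        by (auto intro: mult_left_mono mult_right_mono)
      then have "3 * (norm x * norm x) \<le> cmod z * norm x" "3 * (cmod z * norm x) \<le> cmod z * cmod z"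
        by simp_all
      moreover have "0 \<le> cmod z * cmod z"
        by simp
      ultimately have "2 * (norm x * norm x) + 2 * (cmod z * norm x) \<le> cmod z * cmod z"
        by linarith
      then show ?thesis
        by (simp add: power2_eq_square)
    qed
    moreover have "norm (of_real (2 * Re z) * x) \<le> 2 * cmod z * norm x"
      using abs_Re_le_cmod[of z] by (simp add: norm_mult mult_right_mono)
    moreover have "norm (of_real ((cmod z)\<^sup>2) :: 'k) = (cmod z)\<^sup>2"
      by (simp add: norm_power)
    moreover have "norm (of_real ((cmod z)\<^sup>2) :: 'k) \<le> quad_norm x (- z) + norm (x\<^sup>2 - of_real (2 * Re z) * x)"
      unfolding quad_norm_x by (metis add.commute norm_triangle_sub norm_minus_commute diff_add_cancel add_diff_cancel_left' norm_triangle_ineq4)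
    moreover have "norm (x\<^sup>2 - of_real (2 * Re z) * x) \<le> (norm x)\<^sup>2 + norm (of_real (2 * Re z) * x)"
      using norm_triangle_ineq4[of "x\<^sup>2"] by (simp add: norm_power)
    moreover have "quad_norm x 0 = (norm x)\<^sup>2"
      by (simp add: quad_norm_def norm_power)
    ultimately show ?thesis
      by linarith
  qed
  have "\<exists>w. \<forall>z. quad_norm x (- w) \<le> quad_norm x (- z)"
  proof -
    have "continuous_on (cball 0 (R + norm x)) (\<lambda>z. quad_norm x (- z))"
      unfolding quad_norm_def by (intro continuous_intros)
    moreover have "cball (0::complex) (R + norm x) \<noteq> {}"
      using norm_ge_zero[of x] by (simp add: R_def not_less)
    ultimately obtain w where w: "\<And>z. z \<in> cball 0 (R + norm x) \<Longrightarrow> quad_norm x (- w) \<le> quad_norm x (- z)"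
      using continuous_attains_inf[OF compact_cball] by metis
    have "quad_norm x (- w) \<le> quad_norm x (- z)" for z
    proof (cases "cmod z \<le> R + norm x")
      case False
      have "quad_norm x (- w) \<le> quad_norm x (- 0)"
        by (rule w) (simp add: R_def add_nonneg_nonneg)
      with far[of z] False show ?thesis
        by simp
    qed (use w in simp)
    then show ?thesis
      by blast
  qed
  then obtain w where w: "\<And>z. quad_norm x (- w) \<le> quad_norm x (- z)"
    by blast
  define m where "m = quad_norm x (- w)"
  define y where "y = x - of_real (Re w)"
  have low: "m \<le> quad_norm y z" for z
    using w[of "of_real (Re w) - z"] quad_norm_shift[of x "- Re w" z] by (simp add: y_def m_def)
  have at_w: "norm (y\<^sup>2 + of_real ((Im w)\<^sup>2)) = m"
    by (simp add: m_def y_def quad_norm_def)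
  have "\<not> 0 < m"
  proof
    assume "0 < m"
    have step: "norm (y\<^sup>2 + of_real ((Im w)\<^sup>2 + real k * (m / 2))) = m" for k
    proof (induction k)
      case (Suc k)
      have "norm (y\<^sup>2 + of_real (((Im w)\<^sup>2 + real k * (m / 2)) + m / 2)) = m"
        by (rule minimal_quad_norm_shift[OF low \<open>0 < m\<close> Suc]) (use \<open>0 < m\<close> in auto)
      moreover have "(Im w)\<^sup>2 + real k * (m / 2) + m / 2 = (Im w)\<^sup>2 + real (Suc k) * (m / 2)"
        by (simp add: field_simps)
      ultimately show ?case
        by metis
    qed (use at_w in simp)
    have "real k * (m / 2) \<le> 2 * m" for k
    proof -
      have "norm (of_real (real k * (m / 2)) :: 'k) = norm ((y\<^sup>2 + of_real ((Im w)\<^sup>2 + real k * (m / 2))) - (y\<^sup>2 + of_real ((Im w)\<^sup>2)))"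
        by (rule arg_cong[where f = norm]) simp
      also have "\<dots> \<le> m + m"
        by (rule order_trans[OF norm_triangle_ineq4]) (simp only: step at_w)
      finally show ?thesis
        using \<open>0 < m\<close> by (simp del: of_real_mult of_real_divide)
    qed
    \<comment> \<open>The bound fails as soon as \<open>k > 4\<close>.\<close>
    from this[of 5] \<open>0 < m\<close> show False
      by simp
  qed
  then have "norm (y\<^sup>2 + of_real ((Im w)\<^sup>2)) = 0"
    using at_w norm_ge_zero[of "y\<^sup>2 + of_real ((Im w)\<^sup>2)"] by linarith
  then have "(x - of_real (Re w))\<^sup>2 = - of_real ((Im w)\<^sup>2)"
    by (simp add: y_def eq_neg_iff_add_eq_0)
  then show ?thesis
    by blast
qed

theorem real_normed_field_gelfand_mazur:
  "\<exists>j::'k::real_normed_field. \<forall>x. \<exists>a b. x = of_real a + of_real b * j"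
proof (cases "\<forall>x::'k. \<exists>a. x = of_real a")
  case True
  then show ?thesis
    by (intro exI[of _ 0]) simp
next
  case False
  then obtain x0 :: 'k where x0: "\<And>a. x0 \<noteq> of_real a"
    by blast
  obtain a0 b0 where ab0: "(x0 - of_real a0)\<^sup>2 = - of_real (b0\<^sup>2)"
    using root_of_real_quadratic by blast
  have "b0 \<noteq> 0"
    using ab0 x0[of a0] by auto
  define j where "j = (x0 - of_real a0) / of_real b0"
  have j: "j\<^sup>2 = - 1"
    using ab0 \<open>b0 \<noteq> 0\<close> by (simp add: j_def power_divide)
  have "\<exists>a b. x = of_real a + of_real b * j" for x
  proof -
    obtain a b where ab: "(x - of_real a)\<^sup>2 = - of_real (b\<^sup>2)"
      using root_of_real_quadratic by blast
    then have "(x - of_real a)\<^sup>2 = (of_real b * j)\<^sup>2"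
      by (simp add: power_mult_distrib j)
    then have "x - of_real a = of_real b * j \<or> x - of_real a = of_real (- b) * j"
      by (simp add: power2_eq_iff)
    then have "x = of_real a + of_real b * j \<or> x = of_real a + of_real (- b) * j"
      by (simp only: diff_eq_eq add.commute)
    then show ?thesis
      by blast
  qed
  then show ?thesis
    by blast
qed

corollary real_normed_field_countable_dense:
  "\<exists>Q::'k::real_normed_field set. countable Q \<and> closure Q = UNIV"
proof -
  obtain j :: 'k where j: "\<And>x. \<exists>a b. x = of_real a + of_real b * j"
    using real_normed_field_gelfand_mazur by blast
  define h where "h = (\<lambda>(a, b). of_real a + of_real b * j)"
  have "x \<in> closure (h ` (\<rat> \<times> \<rat>))" for x
  proof -
    obtain a b where "x = of_real a + of_real b * j"
      using j by blast
    then have x: "x = h (a, b)"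
      by (simp add: h_def)
    have "continuous_on UNIV h"
      by (auto simp: h_def case_prod_unfold intro!: continuous_intros)
    then have "h ` closure (\<rat> \<times> \<rat>) \<subseteq> closure (h ` (\<rat> \<times> \<rat>))"
      by (intro image_closure_subset closure_subset) (auto intro: continuous_on_subset)
    then show ?thesis
      by (auto simp: x closure_Times Rats_closure_real)
  qed
  moreover have "countable (h ` (\<rat> \<times> \<rat>))"
    by (intro countable_image countable_SIGMA countable_rat)
  ultimately show ?thesis
    by blast
qed

section \<open>Sequences in weak topologies\<close>

lemma limitin_weak_topology:
  assumes "l \<in> S" and "\<And>n. x n \<in> S" and "\<And>\<phi>. \<phi> \<in> F \<Longrightarrow> (\<lambda>n. \<phi> (x n)) \<longlonglongrightarrow> \<phi> l"
  shows "limitin (weak_topology S F) x l sequentially"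
  unfolding limitin_def
proof (intro conjI allI impI)
  show "l \<in> topspace (weak_topology S F)"
    using assms by simp
  fix U assume "openin (weak_topology S F) U \<and> l \<in> U"
  then have "generate_topology_on (insert S {S \<inter> \<phi> -` U | \<phi> U. \<phi> \<in> F \<and> open U}) U" "l \<in> U"
    by (auto simp: weak_topology_def openin_topology_generated_by_iff)
  then show "eventually (\<lambda>n. x n \<in> U) sequentially"
  proof induction
    case (Int a b)
    then show ?case
      by (auto intro: eventually_conj)
  next
    case (UN K)
    then obtain k where "k \<in> K" "l \<in> k"
      by blast
    with UN.IH[of k] show ?case
      by (auto elim!: eventually_mono)
  next
    case (Basis s)
    then show ?case
      using assms(2) topological_tendstoD[OF assms(3)] by auto
  qed auto
qed

lemma limitin_in_closure_of:
  assumes "limitin T x l sequentially" and "\<And>n::nat. x n \<in> A"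
  shows "l \<in> T closure_of A"
  unfolding in_closure_of
proof (intro conjI allI impI)
  show "l \<in> topspace T"
    using assms(1) by (simp add: limitin_def)
  fix U assume "l \<in> U \<and> openin T U"
  then have "eventually (\<lambda>n. x n \<in> U) sequentially"
    using assms(1) by (auto simp: limitin_def)
  then show "\<exists>y. y \<in> A \<and> y \<in> U"
    using assms(2) by (auto simp: eventually_sequentially)
qed

lemma baire_one_sequence:
  assumes "\<phi> \<in> baire_one smul"
  obtains x where "\<And>f. f \<in> dual_space smul \<Longrightarrow> (\<lambda>n. blinfun_apply f (x n)) \<longlonglongrightarrow> \<phi> f"
proof -
  obtain x where x: "limitin (weak_star_bidual smul) (\<lambda>n. canonical_embedding smul (x n)) \<phi> sequentially"
    using assms by (auto simp: baire_one_def)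
  have "(\<lambda>n. blinfun_apply f (x n)) \<longlonglongrightarrow> \<phi> f" if f: "f \<in> dual_space smul" for f
  proof -
    have "continuous_map (weak_star_bidual smul) euclidean (\<lambda>\<phi>. \<phi> f)"
      unfolding weak_star_bidual_def by (rule continuous_map_weak_topology) (use f in blast)
    from continuous_map_limit[OF this x] show ?thesis
      using f by (simp add: o_def canonical_embedding_def)
  qed
  then show thesis
    by (rule that)
qed

section \<open>Meagre sets of sequences\<close>

definition agree_below :: "nat \<Rightarrow> (nat \<Rightarrow> 'k) \<Rightarrow> (nat \<Rightarrow> 'k) \<Rightarrow> bool"
  where "agree_below N b b' \<longleftrightarrow> (\<forall>i<N. b i = b' i)"

text \<open>
  In this context \<open>F n\<close> is closed and nowhere dense in the space of sequences with entries in \<open>K\<close>,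
  where \<open>K\<close> carries the discrete topology and the basic open sets are the cylinders of all
  sequences with a given prefix.
\<close>

context
  fixes K :: "'k set" and F :: "nat \<Rightarrow> (nat \<Rightarrow> 'k) set"
  assumes closed_F: "\<And>n b. range b \<subseteq> K \<Longrightarrow> b \<notin> F n \<Longrightarrow>
      \<exists>N. \<forall>b'. range b' \<subseteq> K \<longrightarrow> agree_below N b b' \<longrightarrow> b' \<notin> F n"
    and no_cylinder: "\<And>n b N. range b \<subseteq> K \<Longrightarrow>
      \<exists>b'. range b' \<subseteq> K \<and> agree_below N b b' \<and> b' \<notin> F n"
begin

text \<open>
  A single word on \<open>{N..<N'}\<close> serves for finitely many pairs: it is lengthened once for each pair,
  and lengthening preserves what the earlier pairs have already achieved.
\<close>

lemma finitely_many_prefixes_avoid: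
  assumes "finite \<Sigma>" and "\<And>\<sigma> n. (\<sigma>, n) \<in> \<Sigma> \<Longrightarrow> range \<sigma> \<subseteq> K" and "range p \<subseteq> K"
  shows "\<exists>q N'. range q \<subseteq> K \<and> N < N' \<and> agree_below N p q \<and>
     (\<forall>\<sigma> n b. (\<sigma>, n) \<in> \<Sigma> \<longrightarrow> range b \<subseteq> K \<longrightarrow> agree_below N \<sigma> b \<longrightarrow> (\<forall>i\<in>{N..<N'}. b i = q i) \<longrightarrow> b \<notin> F n)"
  using assms(1,2)
proof (induction rule: finite_induct)
  case empty
  then show ?case
    using assms(3) by (intro exI[of _ p] exI[of _ "Suc N"]) (auto simp: agree_below_def)
next
  case (insert s \<Sigma>)
  obtain \<sigma> n where s: "s = (\<sigma>, n)"
    by fastforce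
  have "\<exists>q N'. range q \<subseteq> K \<and> N < N' \<and> agree_below N p q \<and>
     (\<forall>\<sigma> n b. (\<sigma>, n) \<in> \<Sigma> \<longrightarrow> range b \<subseteq> K \<longrightarrow> agree_below N \<sigma> b \<longrightarrow>
       (\<forall>i\<in>{N..<N'}. b i = q i) \<longrightarrow> b \<notin> F n)"
    by (rule insert.IH) (rule insert.prems, rule insertI2)
  then obtain q N1 where q: "range q \<subseteq> K" "N < N1" "agree_below N p q"
     and q_avoids: "\<forall>\<sigma> n b. (\<sigma>, n) \<in> \<Sigma> \<longrightarrow> range b \<subseteq> K \<longrightarrow> agree_below N \<sigma> b \<longrightarrow>
       (\<forall>i\<in>{N..<N1}. b i = q i) \<longrightarrow> b \<notin> F n"
    by (elim exE conjE)
  \<comment> \<open>The new prefix followed by the word found so far, to be continued until it leaves \<open>F n\<close>.\<close>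
  define c where "c = (\<lambda>i. if i < N then \<sigma> i else q i)"
  have "range \<sigma> \<subseteq> K"
    using insert.prems s by blast
  then have "range c \<subseteq> K"
    using q(1) by (auto simp: c_def)
  then obtain c' where c': "range c' \<subseteq> K" "agree_below N1 c c'" "c' \<notin> F n"
    using no_cylinder by blast
  then obtain N2 where N2: "\<And>b'. range b' \<subseteq> K \<Longrightarrow> agree_below N2 c' b' \<Longrightarrow> b' \<notin> F n"
    using closed_F by blast
  define q' where "q' = (\<lambda>i. if i < N then p i else c' i)"
  have q'_q: "q' i = q i" if "i < N1" for i
    using that c'(2) q(3) by (auto simp: q'_def c_def agree_below_def split: if_splits)
  have avoid: "b \<notin> F l" if "(\<tau>, l) \<in> insert s \<Sigma>" and b: "range b \<subseteq> K" "agree_below N \<tau> b"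
      "\<forall>i\<in>{N..<max N1 N2}. b i = q' i" for \<tau> l b
  proof (cases "(\<tau>, l) = s")
    case True
    have "c' i = b i" if "i < N2" for i
    proof (cases "i < N")
      case True
      then have "c' i = c i"
        using c'(2) q(2) by (simp add: agree_below_def)
      also have "\<dots> = b i"
        using b(2) True \<open>(\<tau>, l) = s\<close> s by (simp add: c_def agree_below_def)
      finally show ?thesis .
    next
      case False
      then show ?thesis
        using b(3) that by (simp add: q'_def)
    qed
    then show ?thesis
      using N2[OF b(1)] True s by (simp add: agree_below_def)
  next
    case False
    then have "(\<tau>, l) \<in> \<Sigma>"
      using that(1) by blast
    then show ?thesis
      using b q'_q by (intro q_avoids[rule_format, of \<tau>]) auto
  qed
  have "range q' \<subseteq> K"
    using assms(3) c'(1) by (auto simp: q'_def)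
  moreover have "N < max N1 N2"
    using q(2) by simp
  moreover have "agree_below N p q'"
    by (simp add: q'_def agree_below_def)
  ultimately show ?case
    by (intro exI[of _ q'] exI[of _ "max N1 N2"] conjI allI impI) (assumption | rule avoid)+
qed

text \<open>
  The pattern \<open>p\<close> is built block by block.  The \<open>k\<close>-th block has to take a sequence out of
  \<open>F 0, \<dots>, F k\<close> whatever its prefix was; the only prefixes that can occur are those which choose
  between \<open>p i\<close> and \<open>t\<close> at each index, and there are finitely many of them.  Infinitely many
  matching blocks then take a sequence out of every \<open>F n\<close>.
\<close>

lemma block_pattern:
  assumes "t \<in> K"
  shows "\<exists>p N. range p \<subseteq> K \<and> strict_mono N \<and>
    (\<forall>E. (\<exists>\<^sub>\<infinity>k. {N k..<N (Suc k)} \<subseteq> E) \<longrightarrow> (\<forall>n. (\<lambda>i. if i \<in> E then p i else t) \<notin> F n))"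
proof -
  define Step where "Step k s s' \<longleftrightarrow> snd s < snd s' \<and> agree_below (snd s) (fst s) (fst s') \<and>
    (\<forall>A n b. A \<subseteq> {..<snd s} \<longrightarrow> n \<le> k \<longrightarrow> range b \<subseteq> K \<longrightarrow>
       agree_below (snd s) (\<lambda>i. if i \<in> A then fst s i else t) b \<longrightarrow>
       (\<forall>i\<in>{snd s..<snd s'}. b i = fst s' i) \<longrightarrow> b \<notin> F n)" for k :: nat and s s' :: "(nat \<Rightarrow> 'k) \<times> nat"
  have "\<exists>f. \<forall>k. range (fst (f k)) \<subseteq> K \<and> Step k (f k) (f (Suc k))"
  proof (rule dependent_nat_choice)
    show "\<exists>s::(nat \<Rightarrow> 'k) \<times> nat. range (fst s) \<subseteq> K"
      using assms by (intro exI[of _ "(\<lambda>_. t, 0)"]) auto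
    fix s :: "(nat \<Rightarrow> 'k) \<times> nat" and k :: nat
    assume s: "range (fst s) \<subseteq> K"
    \<comment> \<open>All prefixes that choose between the current pattern and \<open>t\<close>.\<close>
    define \<Sigma> where "\<Sigma> = (\<lambda>A i. if i \<in> A then fst s i else t) ` Pow {..<snd s} \<times> {..k}"
    have "finite \<Sigma>"
      by (simp add: \<Sigma>_def)
    moreover have "range \<sigma> \<subseteq> K" if "(\<sigma>, n) \<in> \<Sigma>" for \<sigma> n
      using that s assms by (auto simp: \<Sigma>_def)
    ultimately obtain q N' where q: "range q \<subseteq> K" "snd s < N'" "agree_below (snd s) (fst s) q"
      and q_avoids: "\<forall>\<sigma> n b. (\<sigma>, n) \<in> \<Sigma> \<longrightarrow> range b \<subseteq> K \<longrightarrow> agree_below (snd s) \<sigma> b \<longrightarrow>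
        (\<forall>i\<in>{snd s..<N'}. b i = q i) \<longrightarrow> b \<notin> F n"
      using finitely_many_prefixes_avoid[of \<Sigma>, OF _ _ s, of "snd s"] by metis
    have "Step k s (q, N')"
      unfolding Step_def
    proof (intro conjI allI impI)
      fix A n b
      assume "A \<subseteq> {..<snd s}" "n \<le> k" and b: "range b \<subseteq> K"
        "agree_below (snd s) (\<lambda>i. if i \<in> A then fst s i else t) b"
        "\<forall>i\<in>{snd s..<snd (q, N')}. b i = fst (q, N') i"
      then have "(\<lambda>i. if i \<in> A then fst s i else t, n) \<in> \<Sigma>"
        by (auto simp: \<Sigma>_def)
      then show "b \<notin> F n"
        using b by (intro q_avoids[rule_format]) auto
    qed (use q in auto)
    with q(1) show "\<exists>s'. range (fst s') \<subseteq> K \<and> Step k s s'"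
      by (intro exI[of _ "(q, N')"]) simp
  qed
  then obtain f where f: "\<And>k. range (fst (f k)) \<subseteq> K" "\<And>k. Step k (f k) (f (Suc k))"
    by blast
  define N where "N k = snd (f k)" for k
  define p where "p i = fst (f (Suc i)) i" for i
  have N: "strict_mono N"
    using f(2) by (auto simp: strict_mono_Suc_iff N_def Step_def)
  have stable: "fst (f (k + j)) i = fst (f k) i" if "i < N k" for i j k
  proof (induction j)
    case (Suc j)
    have "N k \<le> N (k + j)"
      using N by (simp add: strict_mono_less_eq)
    then show ?case
      using Suc f(2)[of "k + j"] that by (simp add: Step_def agree_below_def N_def)
  qed simp
  have p_eq: "fst (f k) i = p i" if "i < N k" for i k
  proof -
    have "i < N (Suc i)"
      using strict_mono_imp_increasing[OF N, of "Suc i"] by simp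
    then show ?thesis
      using stable[of i k "Suc i"] stable[of i "Suc i" k] that by (simp add: p_def add.commute)
  qed
  have "range p \<subseteq> K"
    using f(1) by (auto simp: p_def)
  moreover have "(\<lambda>i. if i \<in> E then p i else t) \<notin> F n" if E: "\<exists>\<^sub>\<infinity>k. {N k..<N (Suc k)} \<subseteq> E" for E n
  proof -
    obtain k where k: "n \<le> k" "{N k..<N (Suc k)} \<subseteq> E"
      using E by (auto simp: INFM_nat_le)
    show ?thesis
    proof (rule f(2)[of k, unfolded Step_def, THEN conjunct2, THEN conjunct2, rule_format, of "E \<inter> {..<N k}"])
      show "range (\<lambda>i. if i \<in> E then p i else t) \<subseteq> K"
        using \<open>range p \<subseteq> K\<close> assms by auto
      show "agree_below (snd (f k)) (\<lambda>i. if i \<in> E \<inter> {..<N k} then fst (f k) i else t)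
         (\<lambda>i. if i \<in> E then p i else t)"
        using p_eq[of _ k] by (auto simp: agree_below_def N_def)
      fix i assume "i \<in> {snd (f k)..<snd (f (Suc k))}"
      then show "(if i \<in> E then p i else t) = fst (f (Suc k)) i"
        using k(2) p_eq[of i "Suc k"] by (auto simp: N_def)
    qed (use k in \<open>auto simp: N_def\<close>)
  qed
  ultimately show ?thesis
    using N by blast
qed

end

section \<open>The adjoint of a bounded surjection onto \<open>\<ell>\<^sup>1\<close>\<close>

text \<open>
  The functionals \<open>g i\<close> are the coordinates of a bounded map from \<open>X\<close> to \<open>\<ell>\<^sup>1\<close>, and \<open>u i\<close> is a
  bounded sequence of preimages of the unit vectors.
\<close>

locale ell1_quotient = banach_over smul
  for smul :: "'k::{real_normed_field,banach} \<Rightarrow> 'a::banach \<Rightarrow> 'a" +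
  fixes g :: "nat \<Rightarrow> 'a \<Rightarrow>\<^sub>L 'k" and u :: "nat \<Rightarrow> 'a" and B M :: real
  assumes g_dual: "g i \<in> dual_space smul"
    and summable_g: "summable (\<lambda>i. norm (g i x))"
    and suminf_g_le: "(\<Sum>i. norm (g i x)) \<le> B * norm x"
    and g_u: "g i (u j) = (if i = j then 1 else 0)"
    and norm_u_le: "norm (u i) \<le> M"
begin

text \<open>
  The adjoint map from \<open>\<ell>\<^sup>\<infinity>\<close> to \<open>X\<^sup>*\<close>; its value is meaningful for bounded \<open>b\<close> only.
\<close>

definition comb :: "(nat \<Rightarrow> 'k) \<Rightarrow> 'a \<Rightarrow>\<^sub>L 'k"
  where "comb b = Blinfun (\<lambda>x. \<Sum>i. b i * g i x)"

lemma summable_norm_comb: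
  assumes "bounded (range b)"
  shows "summable (\<lambda>i. norm (b i * g i x))"
proof -
  obtain c where "\<And>i. norm (b i) \<le> c"
    using assms by (auto simp: bounded_iff)
  then show ?thesis
    by (intro summable_comparison_test'[OF summable_mult[OF summable_g[of x], of c], of 0])
      (auto simp: norm_mult mult_right_mono)
qed

lemmas summable_comb = summable_norm_cancel[OF summable_norm_comb]

lemma norm_suminf_comb_le:
  assumes "\<And>i. norm (b i) \<le> c"
  shows "norm (\<Sum>i. b i * g i x) \<le> c * (\<Sum>i. norm (g i x))"
proof -
  have b: "bounded (range b)"
    using assms by (auto simp: bounded_iff)
  have "norm (\<Sum>i. b i * g i x) \<le> (\<Sum>i. norm (b i * g i x))"
    by (rule summable_norm[OF summable_norm_comb[OF b]])
  also have "\<dots> \<le> (\<Sum>i. c * norm (g i x))"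
    using assms by (intro suminf_le summable_norm_comb b summable_mult summable_g)
      (auto simp: norm_mult mult_right_mono)
  finally show ?thesis
    by (simp add: suminf_mult summable_g)
qed

lemma bounded_linear_comb:
  assumes "bounded (range b)"
  shows "bounded_linear (\<lambda>x. \<Sum>i. b i * g i x)"
proof -
  obtain c where c: "0 \<le> c" "\<And>i. norm (b i) \<le> c"
    using assms by (auto simp: bounded_pos intro: less_imp_le)
  note summable = summable_comb[OF assms]
  show ?thesis
  proof (rule bounded_linear_intro[of _ "c * B"])
    show "(\<Sum>i. b i * g i (x + y)) = (\<Sum>i. b i * g i x) + (\<Sum>i. b i * g i y)" for x y
      by (simp add: blinfun.add_right distrib_left suminf_add summable)
    show "(\<Sum>i. b i * g i (r *\<^sub>R x)) = r *\<^sub>R (\<Sum>i. b i * g i x)" for r x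
      by (simp add: blinfun.scaleR_right suminf_scaleR_right summable)
    have "norm (\<Sum>i. b i * g i x) \<le> c * (B * norm x)" for x
      using norm_suminf_comb_le[of b c x] c mult_left_mono[OF suminf_g_le[of x] c(1)]
      by (rule_tac order_trans) auto
    then show "norm (\<Sum>i. b i * g i x) \<le> norm x * (c * B)" for x
      by (simp add: mult_ac)
  qed
qed

lemma comb_apply:
  assumes "bounded (range b)"
  shows "comb b x = (\<Sum>i. b i * g i x)"
  unfolding comb_def by (simp only: bounded_linear_Blinfun_apply[OF bounded_linear_comb[OF assms]])

lemma comb_sums:
  assumes "bounded (range b)"
  shows "(\<lambda>i. b i * g i x) sums comb b x"
  using summable_sums[OF summable_comb[OF assms]] by (simp add: comb_apply assms)

lemma norm_comb_le:
  assumes "\<And>i. norm (b i) \<le> c"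
  shows "norm (comb b) \<le> c * B"
proof -
  have b: "bounded (range b)"
    using assms by (auto simp: bounded_iff)
  have c: "0 \<le> c"
    using assms[of 0] norm_ge_zero order_trans by blast
  have "0 < norm (u 0)"
    using g_u[of 0 0] by auto
  moreover have "0 \<le> B * norm (u 0)"
    using suminf_nonneg[OF summable_g[of "u 0"]] suminf_g_le[of "u 0"] by auto
  ultimately have "0 \<le> B"
    by (simp add: zero_le_mult_iff)
  show ?thesis
  proof (rule norm_blinfun_bound)
    show "norm (comb b x) \<le> c * B * norm x" for x
      using norm_suminf_comb_le[of b c x] assms c mult_left_mono[OF suminf_g_le[of x] c]
      by (simp add: comb_apply b)
  qed (use c \<open>0 \<le> B\<close> in auto)
qed

lemma comb_u:
  assumes "bounded (range b)"
  shows "comb b (u j) = b j"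
  using sums_unique2[OF comb_sums[OF assms, of "u j"]] sums_single[of j b]
  by (simp add: g_u if_distrib cong: if_cong)

lemma comb_dual:
  assumes "bounded (range b)"
  shows "comb b \<in> dual_space smul"
  unfolding dual_space_def
proof clarify
  fix c x
  have "(\<lambda>i. c * (b i * g i x)) sums (c * comb b x)"
    by (intro sums_mult comb_sums assms)
  moreover have "c * (b i * g i x) = b i * g i (smul c x)" for i
    using g_dual[of i] by (simp add: dual_space_def)
  ultimately show "comb b (smul c x) = c * comb b x"
    using sums_unique2[OF comb_sums[OF assms]] by simp
qed

lemma comb_add:
  assumes "bounded (range b)" "bounded (range b')"
  shows "comb (\<lambda>i. b i + b' i) = comb b + comb b'"
proof (rule blinfun_eqI)
  fix x
  have "bounded (range (\<lambda>i. b i + b' i))"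
    using bounded_plus_comp[OF assms] .
  from comb_sums[OF this, of x] show "comb (\<lambda>i. b i + b' i) x = (comb b + comb b') x"
    using sums_unique2[OF _ sums_add[OF comb_sums[OF assms(1), of x] comb_sums[OF assms(2), of x]]]
    by (simp add: blinfun.add_left distrib_right)
qed

lemma bounded_range_mult: "bounded (range b) \<Longrightarrow> bounded (range (\<lambda>i. c * b i :: 'k))"
  by (auto simp: bounded_iff norm_mult) (meson mult_left_mono norm_ge_zero)

lemma comb_scale:
  assumes "bounded (range b)"
  shows "comb (\<lambda>i. c * b i) = dual_scale c (comb b)"
proof (rule blinfun_eqI)
  fix x
  show "comb (\<lambda>i. c * b i) x = dual_scale c (comb b) x"
    using sums_unique2[OF comb_sums[OF bounded_range_mult[OF assms], of c x, unfolded mult.assoc]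
        sums_mult[OF comb_sums[OF assms], of c x]]
    by simp
qed

lemma comb_agree_le:
  assumes "\<And>i. norm (b i) \<le> c" "\<And>i. norm (b' i) \<le> c" "agree_below N b b'"
  shows "norm (comb b x - comb b' x) \<le> 2 * c * (\<Sum>i. norm (g (i + N) x))"
proof -
  have b: "bounded (range b)" "bounded (range b')"
    using assms(1,2) by (auto simp: bounded_iff)
  let ?d = "\<lambda>i. b i * g i x - b' i * g i x"
  have "?d sums (comb b x - comb b' x)"
    by (intro sums_diff comb_sums b)
  moreover have "(\<Sum>i<N. ?d i) = 0"
    using assms(3) by (intro sum.neutral) (auto simp: agree_below_def)
  ultimately have "(\<lambda>i. ?d (i + N)) sums (comb b x - comb b' x)"
    using sums_iff_shift[of ?d N "comb b x - comb b' x"] by simp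
  then have "comb b x - comb b' x = (\<Sum>i. ?d (i + N))"
    by (rule sums_unique)
  also have "norm \<dots> \<le> (\<Sum>i. 2 * c * norm (g (i + N) x))"
  proof (rule order_trans[OF summable_norm])
    have le: "norm (?d (i + N)) \<le> 2 * c * norm (g (i + N) x)" for i
    proof -
      have "norm (?d (i + N)) = norm (b (i + N) - b' (i + N)) * norm (g (i + N) x)"
        by (simp add: norm_mult flip: left_diff_distrib)
      also have "\<dots> \<le> (c + c) * norm (g (i + N) x)"
        using assms(1,2) by (intro mult_right_mono order_trans[OF norm_triangle_ineq4] add_mono) auto
      finally show ?thesis
        by simp
    qed
    have sum: "summable (\<lambda>i. 2 * c * norm (g (i + N) x))"
      by (intro summable_mult) (simp add: summable_g summable_iff_shift[of "\<lambda>i. norm (g i x)"])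
    show 1: "summable (\<lambda>i. norm (?d (i + N)))"
      by (rule summable_comparison_test'[OF sum, of 0]) (use le in auto)
    show "(\<Sum>i. norm (?d (i + N))) \<le> (\<Sum>i. 2 * c * norm (g (i + N) x))"
      by (rule suminf_le[OF le 1 sum])
  qed
  also have "\<dots> = 2 * c * (\<Sum>i. norm (g (i + N) x))"
    by (intro suminf_mult) (simp add: summable_g summable_iff_shift[of "\<lambda>i. norm (g i x)"])
  finally show ?thesis .
qed

text \<open>
  On bounded sets the adjoint is continuous from the topology of agreement on longer and longer
  prefixes to the weak-star topology.
\<close>

lemma comb_agree_tendsto:
  assumes "\<And>i. norm (b i) \<le> c" and "\<And>N i. norm (b' N i) \<le> c" and "\<And>N. agree_below N b (b' N)"
  shows "(\<lambda>N. comb (b' N) x) \<longlonglongrightarrow> comb b x"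
proof -
  have "(\<lambda>N. \<Sum>i. norm (g (i + N) x)) \<longlonglongrightarrow> 0"
    using suminf_exist_split2[OF summable_g[of x]] .
  then have "(\<lambda>N. 2 * c * (\<Sum>i. norm (g (i + N) x))) \<longlonglongrightarrow> 0"
    by (rule tendsto_mult_right_zero)
  then have "(\<lambda>N. comb b x - comb (b' N) x) \<longlonglongrightarrow> 0"
    by (rule Lim_null_comparison[rotated]) (intro always_eventually allI comb_agree_le assms)
  then have "(\<lambda>N. comb b x - (comb b x - comb (b' N) x)) \<longlonglongrightarrow> comb b x - 0"
    by (intro tendsto_diff tendsto_const)
  then show ?thesis
    by simp
qed

end

section \<open>The copy of \<open>c\<^sub>0\<close>\<close>

lemma dual_scale_of_real: "dual_scale (of_real r) f = r *\<^sub>R f"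
  by (rule blinfun_eqI) (simp add: blinfun.scaleR_left scaleR_conv_of_real)

lemma module_dual_scale: "module dual_scale"
  using vector_space_dual_scale by (simp add: module_iff_vector_space)

lemma dual_space_add:
  "f \<in> dual_space smul \<Longrightarrow> h \<in> dual_space smul \<Longrightarrow> f + h \<in> dual_space smul"
  by (simp add: dual_space_def blinfun.add_left distrib_left)

lemma dual_space_scaleR: "f \<in> dual_space smul \<Longrightarrow> r *\<^sub>R f \<in> dual_space smul"
  by (simp add: dual_space_def blinfun.scaleR_left)

lemma zero_in_dual_space: "0 \<in> dual_space smul"
  by (simp add: dual_space_def)

lemma convex_dual_space: "convex (dual_space smul)"
  unfolding convex_def by (auto intro: dual_space_add dual_space_scaleR)

lemma closed_dual_space: "closed (dual_space smul)"
proof -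
  have "dual_space smul = (\<Inter>c. \<Inter>x. {f. blinfun_apply f (smul c x) = c * blinfun_apply f x})"
    by (auto simp: dual_space_def)
  also have "closed \<dots>"
    by (intro closed_INT ballI closed_Collect_eq continuous_intros)
  finally show ?thesis .
qed

context ell1_quotient
begin

definition finite_combs :: "('a \<Rightarrow>\<^sub>L 'k) set"
  where "finite_combs = {comb b |b N. \<forall>i\<ge>N. b i = 0}"

text \<open>
  The image of \<open>c\<^sub>0\<close> under \<open>comb\<close>: the adjoint is bounded below, so the image is the closure of the
  image of the finitely supported sequences.
\<close>

definition c0_copy :: "('a \<Rightarrow>\<^sub>L 'k) set"
  where "c0_copy = closure finite_combs"

lemma bounded_range_eventually_const:
  fixes b :: "nat \<Rightarrow> 'k"
  assumes "\<And>i. N \<le> i \<Longrightarrow> b i = c"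
  shows "bounded (range b)"
proof -
  have "range b \<subseteq> b ` {..<N} \<union> {c}"
    by (rule image_subsetI, rename_tac i, case_tac "i < N") (simp_all add: assms)
  then show ?thesis
    by (rule bounded_subset[OF finite_imp_bounded, rotated]) simp
qed

lemma finite_combsI: "(\<And>i. N \<le> i \<Longrightarrow> b i = 0) \<Longrightarrow> comb b \<in> finite_combs"
  by (auto simp: finite_combs_def)

lemma finite_combsE:
  assumes "f \<in> finite_combs"
  obtains b N where "f = comb b" "\<And>i. N \<le> i \<Longrightarrow> b i = 0" "bounded (range b)"
  using assms bounded_range_eventually_const unfolding finite_combs_def by blast

lemma finite_combs_dual: "finite_combs \<subseteq> dual_space smul"
  by (auto elim!: finite_combsE intro: comb_dual)

lemma finite_combs_add:
  assumes "f \<in> finite_combs" "h \<in> finite_combs"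
  shows "f + h \<in> finite_combs"
proof -
  obtain b N where b: "f = comb b" "\<And>i. N \<le> i \<Longrightarrow> b i = 0" "bounded (range b)"
    using finite_combsE[OF assms(1)] by blast
  obtain b' N' where b': "h = comb b'" "\<And>i. N' \<le> i \<Longrightarrow> b' i = 0" "bounded (range b')"
    using finite_combsE[OF assms(2)] by blast
  have "f + h = comb (\<lambda>i. b i + b' i)"
    by (simp add: comb_add b b')
  also have "\<dots> \<in> finite_combs"
    by (rule finite_combsI[of "max N N'"]) (simp add: b b')
  finally show ?thesis .
qed

lemma finite_combs_scale:
  assumes "f \<in> finite_combs"
  shows "dual_scale c f \<in> finite_combs"
proof -
  obtain b N where b: "f = comb b" "\<And>i. N \<le> i \<Longrightarrow> b i = 0" "bounded (range b)"
    using finite_combsE[OF assms] by blast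
  then have "dual_scale c f = comb (\<lambda>i. c * b i)"
    by (simp add: comb_scale)
  also have "\<dots> \<in> finite_combs"
    by (rule finite_combsI[of N]) (simp add: b)
  finally show ?thesis .
qed

lemma zero_in_finite_combs: "0 \<in> finite_combs"
proof -
  have "comb (\<lambda>_. 0) \<in> finite_combs"
    by (rule finite_combsI[of 0]) simp
  from finite_combs_scale[OF this, of 0] show ?thesis
    using dual_scale_of_real[of 0 "comb (\<lambda>_. 0)"] by simp
qed

lemma c0_copy_dual: "c0_copy \<subseteq> dual_space smul"
  unfolding c0_copy_def by (intro closure_minimal finite_combs_dual closed_dual_space)

lemma subspace_c0_copy: "module.subspace dual_scale c0_copy"
  unfolding module.subspace_def[OF module_dual_scale]
proof (intro conjI ballI allI)
  show "0 \<in> c0_copy"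
    using zero_in_finite_combs closure_subset by (auto simp: c0_copy_def)
  show "f + h \<in> c0_copy" if fh: "f \<in> c0_copy" "h \<in> c0_copy" for f h
  proof -
    obtain s s' where "\<And>n. s n \<in> finite_combs" "s \<longlonglongrightarrow> f" "\<And>n. s' n \<in> finite_combs" "s' \<longlonglongrightarrow> h"
      using fh by (auto simp: c0_copy_def closure_sequential)
    then show ?thesis
      unfolding c0_copy_def closure_sequential
      by (intro exI[of _ "\<lambda>n. s n + s' n"] conjI allI tendsto_intros finite_combs_add)
  qed
  show "dual_scale c f \<in> c0_copy" if f: "f \<in> c0_copy" for c f
  proof -
    obtain s where "\<And>n. s n \<in> finite_combs" "s \<longlonglongrightarrow> f"
      using f by (auto simp: c0_copy_def closure_sequential)
    then show ?thesis
      unfolding c0_copy_def closure_sequential dual_scale_def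
      by (intro exI[of _ "\<lambda>n. blinfun_mult_right c o\<^sub>L s n"] conjI allI tendsto_intros
          finite_combs_scale[unfolded dual_scale_def]) auto
  qed
qed

lemma c0_copy_scaleR: "f \<in> c0_copy \<Longrightarrow> r *\<^sub>R f \<in> c0_copy"
  using subspace_c0_copy unfolding module.subspace_def[OF module_dual_scale]
  by (metis dual_scale_of_real)

lemma convex_c0_copy: "convex c0_copy"
  using subspace_c0_copy c0_copy_scaleR unfolding module.subspace_def[OF module_dual_scale] convex_def
  by metis

lemma c0_copy_has_countable_dense_subset:
  obtains D where "countable D" "D \<noteq> {}" "D \<subseteq> c0_copy" "c0_copy \<subseteq> closure D"
proof -
  obtain Q :: "'k set" where Q: "countable Q" "closure Q = UNIV"
    using real_normed_field_countable_dense by blast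
  define v where "v l = (\<lambda>i. if i < length l then l ! i else 0)" for l :: "'k list"
  define D where "D = (\<lambda>l. comb (v l)) ` lists Q"
  have D: "D \<subseteq> finite_combs"
  proof (clarsimp simp: D_def)
    show "comb (v l) \<in> finite_combs" for l
      by (rule finite_combsI[of "length l"]) (simp add: v_def)
  qed
  have "finite_combs \<subseteq> closure D"
  proof
    fix f assume "f \<in> finite_combs"
    then obtain b N where b: "f = comb b" "\<And>i. N \<le> i \<Longrightarrow> b i = 0"
      by (auto simp: finite_combs_def)
    show "f \<in> closure D"
      unfolding closure_approachable
    proof (intro allI impI)
      fix \<epsilon> :: real assume "0 < \<epsilon>"
      \<comment> \<open>The summand 1 only guards against \<open>B = 0\<close>.\<close>
      define \<delta> where "\<delta> = \<epsilon> / (\<bar>B\<bar> + 1)"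
      have "0 < \<delta>"
        using \<open>0 < \<epsilon>\<close> by (simp add: \<delta>_def add_nonneg_pos)
      have "\<exists>q\<in>Q. dist q (b i) < \<delta>" for i
        using Q(2) \<open>0 < \<delta>\<close> closure_approachable[of "b i" Q] by auto
      then obtain q where q: "\<And>i. q i \<in> Q" "\<And>i. dist (q i) (b i) < \<delta>"
        by metis
      define l where "l = map q [0..<N]"
      have "l \<in> lists Q"
        using q(1) by (auto simp: l_def)
      have v: "bounded (range (v l))" "bounded (range b)"
        by (rule bounded_range_eventually_const[of "length l" _ 0], simp add: v_def)
          (rule bounded_range_eventually_const, rule b(2))
      have "norm (v l i + (- 1) * b i) \<le> \<delta>" for i
        using q(2)[of i] b(2)[of i] \<open>0 < \<delta>\<close> by (auto simp: v_def l_def dist_norm intro: less_imp_le)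
      then have "norm (comb (\<lambda>i. v l i + (- 1) * b i)) \<le> \<delta> * B"
        by (rule norm_comb_le)
      moreover have "comb (\<lambda>i. v l i + (- 1) * b i) = comb (v l) - f"
        using comb_add[OF v(1) bounded_range_mult[OF v(2), of "- 1"]] comb_scale[OF v(2), of "- 1"]
          dual_scale_of_real[of "- 1" f] by (simp add: b(1))
      moreover have "\<delta> * B \<le> \<delta> * \<bar>B\<bar>"
        using \<open>0 < \<delta>\<close> by simp
      moreover have "\<delta> * \<bar>B\<bar> < \<epsilon>"
        using \<open>0 < \<epsilon>\<close> by (simp add: \<delta>_def field_simps)
      ultimately have "dist (comb (v l)) f < \<epsilon>"
        by (simp add: dist_norm)
      then show "\<exists>y\<in>D. dist y f < \<epsilon>"
        using \<open>l \<in> lists Q\<close> by (auto simp: D_def)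
    qed
  qed
  then have "c0_copy \<subseteq> closure D"
    by (simp add: c0_copy_def closure_minimal)
  moreover have "countable D"
    unfolding D_def by (intro countable_image countable_lists Q)
  moreover have "D \<noteq> {}"
    by (auto simp: D_def)
  moreover have "D \<subseteq> c0_copy"
    using D closure_subset by (auto simp: c0_copy_def)
  ultimately show thesis
    using that by blast
qed

lemma separable_c0_copy: "separable_space (top_of_set c0_copy)"
proof -
  obtain D where D: "countable D" "D \<subseteq> c0_copy" "c0_copy \<subseteq> closure D"
    using c0_copy_has_countable_dense_subset by metis
  then have "top_of_set c0_copy closure_of D = c0_copy"
    by (simp add: closure_of_subtopology Int_absorb2 inf.absorb1 inf.absorb2)
  with D show ?thesis
    by (auto simp: separable_space_def)
qed

definition all_one :: "'a \<Rightarrow>\<^sub>L 'k"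
  where "all_one = comb (\<lambda>_. 1)"

lemma M_pos: "0 < M"
proof -
  have "norm (u 0) \<noteq> 0"
    using g_u[of 0 0] by auto
  then show ?thesis
    using norm_u_le[of 0] norm_ge_zero[of "u 0"] by linarith
qed

text \<open>
  Evaluation at \<open>u N\<close> separates \<open>all_one\<close> from all \<open>comb b\<close> with \<open>b N = 0\<close> by 1, and the norms of
  the \<open>u N\<close> are bounded.
\<close>

lemma all_one_notin_c0_copy: "all_one \<notin> c0_copy"
proof
  assume "all_one \<in> c0_copy"
  then obtain f where f: "f \<in> finite_combs" "dist f all_one < 1 / M"
    using M_pos unfolding c0_copy_def closure_approachable by (meson zero_less_divide_1_iff)
  obtain b N where b: "f = comb b" "\<And>i. N \<le> i \<Longrightarrow> b i = 0" and bd: "bounded (range b)"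
    using finite_combsE[OF f(1)] by blast
  have bd1: "bounded (range (\<lambda>_::nat. 1 :: 'k))"
    by simp
  have "(f - all_one) (u N) = - 1"
    using b by (simp add: all_one_def comb_u bd bd1 blinfun.diff_left)
  then have "1 \<le> norm (f - all_one) * norm (u N)"
    using norm_blinfun[of "f - all_one" "u N"] by simp
  also have "\<dots> \<le> norm (f - all_one) * M"
    by (intro mult_left_mono norm_u_le) simp
  also have "\<dots> < 1"
    using f(2) M_pos by (simp add: dist_norm field_simps)
  finally show False
    by simp
qed

end

section \<open>Convexity and (I)-envelopes\<close>

text \<open>
  Zorn's lemma gives a maximal convex set \<open>C\<close> that contains \<open>W\<close> but not \<open>z\<close>.  By maximality a
  point outside \<open>C\<close> lies on a ray that starts at \<open>z\<close> and points away from some \<open>c \<in> C\<close>.  If a convex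
  combination of two such points were in \<open>C\<close>, then \<open>z\<close> would be a convex combination of it and the two
  corresponding points \<open>c\<close>, so it would be in \<open>C\<close>.  Such a \<open>C\<close> is an algebraic form of a half-space
  and replaces a separating functional.
\<close>

lemma maximal_convex_avoiding:
  fixes W :: "'v::real_vector set"
  assumes "convex W" "z \<notin> W" "W \<noteq> {}"
  obtains C where "W \<subseteq> C" "convex C" "convex (- C)" "z \<notin> C"
proof -
  let ?\<A> = "{C. W \<subseteq> C \<and> convex C \<and> z \<notin> C}"
  have "\<exists>M\<in>?\<A>. \<forall>X\<in>?\<A>. M \<subseteq> X \<longrightarrow> X = M"
  proof (rule subset_Zorn_nonempty)
    show "?\<A> \<noteq> {}"
      using assms by blast
    fix \<C> assume \<C>: "\<C> \<noteq> {}" "subset.chain ?\<A> \<C>"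
    have "convex (\<Union>\<C>)"
      unfolding convex_def
    proof (intro ballI allI impI)
      fix x y u v assume "x \<in> \<Union>\<C>" "y \<in> \<Union>\<C>" and uv: "0 \<le> u" "0 \<le> v" "u + v = (1::real)"
      then obtain S T where "S \<in> \<C>" "T \<in> \<C>" "x \<in> S" "y \<in> T"
        by blast
      moreover then have "S \<subseteq> T \<or> T \<subseteq> S"
        using \<C>(2) by (auto simp: subset_chain_def)
      ultimately obtain S where "S \<in> \<C>" "x \<in> S" "y \<in> S"
        by blast
      moreover then have "convex S"
        using \<C>(2) by (auto simp: subset_chain_def)
      ultimately show "u *\<^sub>R x + v *\<^sub>R y \<in> \<Union>\<C>"
        using uv by (auto dest: convexD)
    qed
    then show "\<Union>\<C> \<in> ?\<A>"
      using \<C> by (auto simp: subset_chain_def)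
  qed
  then obtain C where C_max: "C \<in> ?\<A>" "\<forall>X\<in>?\<A>. C \<subseteq> X \<longrightarrow> X = C"
    by (rule bexE)
  then have C: "W \<subseteq> C" "convex C" "z \<notin> C"
    by simp_all
  have maximal: "X = C" if "convex X" "z \<notin> X" "C \<subseteq> X" for X
    using C_max(2) C(1) that by simp
  have "C \<noteq> {}"
    using C(1) assms(3) by blast
  have beyond: "\<exists>c\<in>C. \<exists>\<mu>\<ge>0. x = z + \<mu> *\<^sub>R (z - c)" if "x \<notin> C" for x
  proof -
    have "C \<subseteq> convex hull (insert x C)" "x \<in> convex hull (insert x C)"
      by (auto intro: hull_inc)
    then have "z \<in> convex hull (insert x C)"
      using maximal[of "convex hull (insert x C)"] that convex_convex_hull by blast
    then obtain u v c where uv: "0 \<le> u" "0 \<le> v" "u + v = 1" "c \<in> C" "z = u *\<^sub>R x + v *\<^sub>R c"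
      unfolding convex_hull_insert[OF \<open>C \<noteq> {}\<close>] hull_same[of convex C, OF C(2)] by blast
    have "u \<noteq> 0"
      using uv C(3) by auto
    have "u *\<^sub>R x = (u + v) *\<^sub>R z - v *\<^sub>R c"
      using uv(3,5) by simp
    also have "\<dots> = u *\<^sub>R (z + (v / u) *\<^sub>R (z - c))"
      using \<open>u \<noteq> 0\<close>
      by (simp add: scaleR_left_distrib scaleR_right_distrib scaleR_right_diff_distrib)
    finally have "x = z + (v / u) *\<^sub>R (z - c)"
      using \<open>u \<noteq> 0\<close> by simp
    then show ?thesis
      using uv divide_nonneg_nonneg[of v u] by blast
  qed
  have "convex (- C)"
    unfolding convex_def
  proof (intro ballI allI impI)
    fix x y u v assume "x \<in> - C" "y \<in> - C" and uv: "0 \<le> u" "0 \<le> v" "u + v = (1::real)"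
    obtain c \<mu> where c: "c \<in> C" "0 \<le> \<mu>" "x = z + \<mu> *\<^sub>R (z - c)"
      using beyond \<open>x \<in> - C\<close> by blast
    obtain d \<nu> where d: "d \<in> C" "0 \<le> \<nu>" "y = z + \<nu> *\<^sub>R (z - d)"
      using beyond \<open>y \<in> - C\<close> by blast
    show "u *\<^sub>R x + v *\<^sub>R y \<in> - C"
    proof
      assume in_C: "u *\<^sub>R x + v *\<^sub>R y \<in> C"
      define s where "s = 1 + u * \<mu> + v * \<nu>"
      have "0 < s"
        using uv c(2) d(2) by (simp add: s_def add_pos_nonneg)
      have "u *\<^sub>R x + v *\<^sub>R y = (u + v) *\<^sub>R z + (u * \<mu>) *\<^sub>R (z - c) + (v * \<nu>) *\<^sub>R (z - d)"
        by (simp add: c(3) d(3) algebra_simps)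
      then have "u *\<^sub>R x + v *\<^sub>R y + (u * \<mu>) *\<^sub>R c + (v * \<nu>) *\<^sub>R d = s *\<^sub>R z"
        by (simp add: uv(3) s_def algebra_simps)
      then have "z = (1 / s) *\<^sub>R (u *\<^sub>R x + v *\<^sub>R y + (u * \<mu>) *\<^sub>R c + (v * \<nu>) *\<^sub>R d)"
        using \<open>0 < s\<close> by simp
      also have "\<dots> = (1 / s) *\<^sub>R (u *\<^sub>R x + v *\<^sub>R y) + (u * \<mu> / s) *\<^sub>R c + (v * \<nu> / s) *\<^sub>R d"
        by (simp add: scaleR_right_distrib divide_inverse mult.commute)
      also have "\<dots> \<in> convex hull {u *\<^sub>R x + v *\<^sub>R y, c, d}"
      proof -
        have "1 / s + u * \<mu> / s + v * \<nu> / s = 1"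
          using \<open>0 < s\<close> by (simp add: s_def flip: add_divide_distrib)
        moreover have "0 \<le> 1 / s" "0 \<le> u * \<mu> / s" "0 \<le> v * \<nu> / s"
          using \<open>0 < s\<close> uv c(2) d(2) by auto
        ultimately show ?thesis
          unfolding convex_hull_3 by blast
      qed
      also have "\<dots> \<subseteq> C"
        using in_C c(1) d(1) C(2) by (intro hull_minimal) auto
      finally show False
        using C(3) by blast
    qed
  qed
  with C show thesis
    using that by blast
qed

text \<open>
  Norm balls are weak-star closed, being defined by conditions on the values at single points.
\<close>

lemma weak_star_closure_of_cball:
  assumes "A \<subseteq> cball d r" "0 \<le> r"
  shows "weak_star_dual smul closure_of A \<subseteq> cball d r"
proof
  fix f assume f: "f \<in> weak_star_dual smul closure_of A"
  have "norm (blinfun_apply (d - f) x) \<le> r * norm x" for x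
  proof -
    have "continuous_map (weak_star_dual smul) euclidean (\<lambda>f. blinfun_apply f x)"
      unfolding weak_star_dual_def by (rule continuous_map_weak_topology) blast
    from continuous_map_image_closure_subset[OF this, of A]
    have "blinfun_apply f x \<in> closure ((\<lambda>f. blinfun_apply f x) ` A)"
      using f by auto
    also have "\<dots> \<subseteq> cball (blinfun_apply d x) (r * norm x)"
    proof (intro closure_minimal closed_cball image_subsetI)
      fix h assume "h \<in> A"
      then have "norm (d - h) \<le> r"
        using assms(1) by (auto simp: dist_norm)
      then have "norm (blinfun_apply (d - h) x) \<le> r * norm x"
        using norm_blinfun[of "d - h" x] mult_right_mono[of "norm (d - h)" r "norm x"] by simp
      then show "blinfun_apply h x \<in> cball (blinfun_apply d x) (r * norm x)"
        by (simp add: dist_norm blinfun.diff_left)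
    qed
    finally show ?thesis
      by (simp add: dist_norm blinfun.diff_left)
  qed
  then have "norm (d - f) \<le> r"
    using assms(2) by (rule norm_blinfun_bound[rotated])
  then show "f \<in> cball d r"
    by (simp add: dist_norm)
qed

text \<open>
  Cover \<open>A\<close> by its intersections with balls of small radius \<open>\<eta>\<close> centred at the points of a
  countable dense subset.  The weak-star closed convex hulls of these pieces stay in the balls, so everything built
  from them stays within \<open>2 \<eta>\<close> of the convex set \<open>A\<close>.
\<close>

lemma I_envelope_subset_closure:
  assumes "convex A" and D: "countable D" "D \<noteq> {}" "D \<subseteq> A" "A \<subseteq> closure D"
  shows "I_envelope smul A \<subseteq> closure A"
proof
  fix f assume f: "f \<in> I_envelope smul A"
  show "f \<in> closure A"
    unfolding closure_approachable
  proof (intro allI impI)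
    fix \<epsilon> :: real assume "0 < \<epsilon>"
    define \<eta> where "\<eta> = \<epsilon> / 2"
    have "0 < \<eta>"
      using \<open>0 < \<epsilon>\<close> by (simp add: \<eta>_def)
    define d where "d = from_nat_into D"
    define B where "B n = A \<inter> cball (d n) \<eta>" for n
    have range_d: "range d = D"
      unfolding d_def using D(1,2) by (rule range_from_nat_into[rotated])
    have "A = (\<Union>n. B n)"
    proof
      show "A \<subseteq> (\<Union>n. B n)"
      proof
        fix a assume "a \<in> A"
        with D(4) have "a \<in> closure D"
          by blast
        then obtain y where "y \<in> D" "dist y a < \<eta>"
          using \<open>0 < \<eta>\<close> unfolding closure_approachable by blast
        then show "a \<in> (\<Union>n. B n)"
          using \<open>a \<in> A\<close> range_d by (auto simp: B_def intro: less_imp_le)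
      qed
    qed (auto simp: B_def)
    then have "f \<in> closure (convex hull (\<Union>n. weak_star_dual smul closure_of (convex hull (B n))))"
      using f unfolding I_envelope_def by blast
    moreover have "convex hull (\<Union>n. weak_star_dual smul closure_of (convex hull (B n)))
        \<subseteq> (\<Union>a\<in>A. \<Union>h\<in>cball 0 \<eta>. {a + h})"
    proof (rule hull_minimal)
      show "convex (\<Union>a\<in>A. \<Union>h\<in>cball 0 \<eta>. {a + h})"
        by (intro convex_sums convex_cball assms(1))
      show "(\<Union>n. weak_star_dual smul closure_of (convex hull (B n)))
          \<subseteq> (\<Union>a\<in>A. \<Union>h\<in>cball 0 \<eta>. {a + h})"
      proof (rule UN_least)
        fix n
        have "weak_star_dual smul closure_of (convex hull (B n)) \<subseteq> cball (d n) \<eta>"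
          using \<open>0 < \<eta>\<close> by (intro weak_star_closure_of_cball hull_minimal) (auto simp: B_def)
        also have "\<dots> \<subseteq> (\<Union>h\<in>cball 0 \<eta>. {d n + h})"
        proof
          fix h assume "h \<in> cball (d n) \<eta>"
          then show "h \<in> (\<Union>h\<in>cball 0 \<eta>. {d n + h})"
            by (intro UN_I[of "h - d n"]) (simp_all add: dist_norm norm_minus_commute)
        qed
        also have "\<dots> \<subseteq> (\<Union>a\<in>A. \<Union>h\<in>cball 0 \<eta>. {a + h})"
          using range_d D(3) by (intro UN_upper) auto
        finally show "weak_star_dual smul closure_of (convex hull (B n))
          \<subseteq> (\<Union>a\<in>A. \<Union>h\<in>cball 0 \<eta>. {a + h})" .
      qed
    qed
    ultimately have "f \<in> closure (\<Union>a\<in>A. \<Union>h\<in>cball 0 \<eta>. {a + h})"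
      using closure_mono by blast
    then obtain y where "y \<in> (\<Union>a\<in>A. \<Union>h\<in>cball 0 \<eta>. {a + h})" "dist y f < \<eta>"
      using \<open>0 < \<eta>\<close> unfolding closure_approachable by blast
    then obtain a h where "a \<in> A" "norm h \<le> \<eta>" "dist (a + h) f < \<eta>"
      by auto
    then have "dist a f < \<epsilon>"
      using dist_triangle[of a f "a + h"] by (simp add: \<eta>_def dist_norm)
    then show "\<exists>y\<in>A. dist y f < \<epsilon>"
      using \<open>a \<in> A\<close> by blast
  qed
qed

context ell1_quotient
begin

section \<open>Weak sequential completeness of \<open>\<ell>\<^sup>1\<close>\<close>

text \<open>
  Sequentially closed sets are closed in the topology generated by the cylinders, in the form required by
  \<open>block_pattern\<close>.
\<close>

lemma avoids_closed_under_agreement: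
  assumes seq: "\<And>b b'. range b \<subseteq> K \<Longrightarrow> (\<And>N. range (b' N) \<subseteq> K) \<Longrightarrow> (\<And>N. agree_below N b (b' N)) \<Longrightarrow>
      (\<And>N. b' N \<in> F) \<Longrightarrow> b \<in> F"
    and "range b \<subseteq> K" "b \<notin> F"
  shows "\<exists>N. \<forall>b'. range b' \<subseteq> K \<longrightarrow> agree_below N b b' \<longrightarrow> b' \<notin> F"
proof (rule ccontr)
  assume "\<not> ?thesis"
  then obtain b' where "\<And>N. range (b' N) \<subseteq> K \<and> agree_below N b (b' N) \<and> b' N \<in> F"
    by metis
  then have "b \<in> F"
    using seq[of b b'] assms(2) by blast
  with assms(3) show False ..
qed

lemma bounded_range_cball: "range b \<subseteq> cball 0 r \<Longrightarrow> bounded (range b)"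
  using bounded_subset bounded_cball by blast

lemma comb_agree_tendsto_cball:
  assumes "range b \<subseteq> cball 0 r" "\<And>N. range (b' N) \<subseteq> cball 0 r" "\<And>N. agree_below N b (b' N)"
  shows "(\<lambda>N. comb (b' N) x) \<longlonglongrightarrow> comb b x"
  by (rule comb_agree_tendsto[of _ r]) (use assms in \<open>auto simp: image_subset_iff\<close>)

text \<open>
  By pointwise convergence the sets \<open>F M\<close> of 0-1 sequences \<open>b\<close> for which
  \<open>n \<mapsto> comb b (x n)\<close> varies by at most \<open>\<epsilon>\<close> from index \<open>M\<close> on are closed and
  cover the space of 0-1 sequences.  By Baire category one of them contains a cylinder.  A late tail
  \<open>(0, \<dots>, 0, 1, 1, \<dots>)\<close> is the difference of two elements of the cylinder, so for it the
  variation is at most \<open>2 \<epsilon>\<close>, with the same \<open>M\<close> for all late tails.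
\<close>

lemma uniformly_small_tails:
  assumes lim: "\<And>b. bounded (range b) \<Longrightarrow> (\<lambda>n. comb b (x n)) \<longlonglongrightarrow> \<phi> (comb b)" and "0 < \<epsilon>"
  shows "\<exists>m N. \<forall>k\<ge>N. norm (comb (\<lambda>i. if i < k then 0 else 1) (x m) - \<phi> (comb (\<lambda>i. if i < k then 0 else 1))) \<le> 2 * \<epsilon>"
proof -
  let ?K = "{0, 1} :: 'k set"
  define F where "F M = {b. \<forall>n\<ge>M. \<forall>m\<ge>M. norm (comb b (x n) - comb b (x m)) \<le> \<epsilon>}" for M
  have K: "range b \<subseteq> cball 0 1" if "range b \<subseteq> ?K" for b :: "nat \<Rightarrow> 'k"
  proof -
    have "?K \<subseteq> cball 0 1"
      by simp
    with that show ?thesis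
      by (rule subset_trans)
  qed
  have closed: "\<exists>N. \<forall>b'. range b' \<subseteq> ?K \<longrightarrow> agree_below N b b' \<longrightarrow> b' \<notin> F M"
    if "range b \<subseteq> ?K" "b \<notin> F M" for b M
  proof (rule avoids_closed_under_agreement[OF _ that])
    fix b :: "nat \<Rightarrow> 'k" and b'
    assume *: "range b \<subseteq> ?K" "\<And>N. range (b' N) \<subseteq> ?K" "\<And>N. agree_below N b (b' N)" "\<And>N. b' N \<in> F M"
    note tendsto = comb_agree_tendsto_cball[OF K[OF *(1)] K[OF *(2)] *(3)]
    have "norm (comb b (x n) - comb b (x m)) \<le> \<epsilon>" if "n \<ge> M" "m \<ge> M" for n m
    proof (rule LIMSEQ_le_const2)
      show "(\<lambda>N. norm (comb (b' N) (x n) - comb (b' N) (x m))) \<longlonglongrightarrow> norm (comb b (x n) - comb b (x m))"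
        by (intro tendsto_intros tendsto)
      show "\<exists>N. \<forall>k\<ge>N. norm (comb (b' k) (x n) - comb (b' k) (x m)) \<le> \<epsilon>"
        using *(4) that by (auto simp: F_def)
    qed
    then show "b \<in> F M"
      by (simp add: F_def)
  qed
  have "\<exists>M b N. range b \<subseteq> ?K \<and> (\<forall>b'. range b' \<subseteq> ?K \<longrightarrow> agree_below N b b' \<longrightarrow> b' \<in> F M)"
  proof (rule ccontr)
    assume no: "\<not> ?thesis"
    have no_cylinder: "\<exists>b'. range b' \<subseteq> ?K \<and> agree_below N b b' \<and> b' \<notin> F M" if "range b \<subseteq> ?K" for M b N
      using no that by blast
    have "\<exists>p N. range p \<subseteq> ?K \<and> strict_mono N \<and>
      (\<forall>E. (\<exists>\<^sub>\<infinity>k. {N k..<N (Suc k)} \<subseteq> E) \<longrightarrow> (\<forall>n. (\<lambda>i. if i \<in> E then p i else 0) \<notin> F n))"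
    proof (rule block_pattern)
      show "\<exists>N. \<forall>b'. range b' \<subseteq> ?K \<longrightarrow> agree_below N b b' \<longrightarrow> b' \<notin> F M"
        if "range b \<subseteq> ?K" "b \<notin> F M" for b M
        by (rule closed[OF that])
      show "\<exists>b'. range b' \<subseteq> ?K \<and> agree_below N b b' \<and> b' \<notin> F M" if "range b \<subseteq> ?K" for M b N
        by (rule no_cylinder[OF that])
    qed simp
    then obtain p N where p: "range p \<subseteq> ?K"
      "\<forall>E. (\<exists>\<^sub>\<infinity>k. {N k..<N (Suc k)} \<subseteq> E) \<longrightarrow> (\<forall>n. (\<lambda>i. if i \<in> E then p i else 0) \<notin> F n)"
      by (elim exE conjE)
    have "p \<notin> F n" for n
      using p(2)[rule_format, of UNIV n] by simp
    moreover have "convergent (\<lambda>n. comb p (x n))"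
      using lim[OF bounded_range_cball[OF K[OF p(1)]]] by (auto simp: convergent_def)
    then obtain M where "\<forall>m\<ge>M. \<forall>n\<ge>M. norm (comb p (x m) - comb p (x n)) < \<epsilon>"
      using \<open>0 < \<epsilon>\<close> by (meson Cauchy_iff convergent_Cauchy)
    then have "p \<in> F M"
      by (auto simp: F_def intro: less_imp_le)
    ultimately show False
      by blast
  qed
  then obtain M b N where b: "range b \<subseteq> ?K" "\<And>b'. range b' \<subseteq> ?K \<Longrightarrow> agree_below N b b' \<Longrightarrow> b' \<in> F M"
    by blast
  have "norm (comb (\<lambda>i. if i < k then 0 else 1) (x M) - \<phi> (comb (\<lambda>i. if i < k then 0 else 1))) \<le> 2 * \<epsilon>"
    if "N \<le> k" for k
  proof -
    let ?tail = "\<lambda>i. if i < k then 0 else 1 :: 'k"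
    \<comment> \<open>Two elements of the cylinder whose difference is the tail.\<close>
    define c where "c = (\<lambda>i. if i < N then b i else 0)"
    define d where "d = (\<lambda>i. c i + ?tail i)"
    have b01: "b i = 0 \<or> b i = 1" for i
      using b(1) by auto
    have "c i \<in> ?K" "d i \<in> ?K" for i
      using b01[of i] \<open>N \<le> k\<close> by (auto simp: c_def d_def)
    then have c01: "range c \<subseteq> ?K" and d01: "range d \<subseteq> ?K" and t01: "range ?tail \<subseteq> ?K"
      by auto
    note bd = bounded_range_cball[OF K[OF c01]] bounded_range_cball[OF K[OF t01]]
    have F: "c \<in> F M" "d \<in> F M"
      by (rule b(2)[OF c01], simp add: agree_below_def c_def)
        (rule b(2)[OF d01], use \<open>N \<le> k\<close> in \<open>simp add: agree_below_def c_def d_def\<close>)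
    have diff_le: "norm (comb c (x M) - comb c (x n)) \<le> \<epsilon>" "norm (comb d (x M) - comb d (x n)) \<le> \<epsilon>"
      if "M \<le> n" for n
      using F that by (auto simp: F_def)
    have le: "norm (comb ?tail (x M) - comb ?tail (x n)) \<le> 2 * \<epsilon>" if "M \<le> n" for n
    proof -
      have "comb d = comb c + comb ?tail"
        unfolding d_def by (rule comb_add[OF bd])
      then have "comb ?tail (x M) - comb ?tail (x n) =
          (comb d (x M) - comb d (x n)) - (comb c (x M) - comb c (x n))"
        by (simp add: blinfun.add_left)
      also have "norm \<dots> \<le> norm (comb d (x M) - comb d (x n)) + norm (comb c (x M) - comb c (x n))"
        by (rule norm_triangle_ineq4)
      also have "\<dots> \<le> 2 * \<epsilon>"
        using add_mono[OF diff_le(2,1), of n n] that by simp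
      finally show ?thesis .
    qed
    show ?thesis
    proof (rule LIMSEQ_le_const2)
      show "(\<lambda>n. norm (comb ?tail (x M) - comb ?tail (x n))) \<longlonglongrightarrow> norm (comb ?tail (x M) - \<phi> (comb ?tail))"
        by (intro tendsto_norm tendsto_diff tendsto_const lim bd)
      show "\<exists>N. \<forall>n\<ge>N. norm (comb ?tail (x M) - comb ?tail (x n)) \<le> 2 * \<epsilon>"
        using le by blast
    qed
  qed
  then show ?thesis
    by blast
qed

text \<open>
  For a fixed \<open>m\<close> the tails tend to 0 at the single point \<open>x m\<close> because the coordinates of \<open>x m\<close>
  are absolutely summable; with the uniform estimate above, \<open>\<phi>\<close> tends to 0 on the tails.
\<close>

lemma baire_one_head_tendsto:
  assumes "\<phi> \<in> baire_one smul"
  shows "(\<lambda>k. \<phi> (comb (\<lambda>i. if i < k then 1 else 0))) \<longlonglongrightarrow> \<phi> all_one"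
proof -
  let ?tail = "\<lambda>k i. if i < k then 0 else 1 :: 'k"
  let ?head = "\<lambda>k i. if i < k then 1 else 0 :: 'k"
  obtain x where x: "\<And>f. f \<in> dual_space smul \<Longrightarrow> (\<lambda>n. blinfun_apply f (x n)) \<longlonglongrightarrow> \<phi> f"
    using baire_one_sequence[OF assms] by blast
  have lim: "(\<lambda>n. comb b (x n)) \<longlonglongrightarrow> \<phi> (comb b)" if "bounded (range b)" for b
    by (intro x comb_dual that)
  have ball: "range (?tail k) \<subseteq> cball 0 1" "range (?head k) \<subseteq> cball 0 1" "range (\<lambda>_::nat. 0::'k) \<subseteq> cball 0 1" for k
    by auto
  note bd = bounded_range_cball[OF ball(1)] bounded_range_cball[OF ball(2)]
  have "(\<lambda>k. \<phi> (comb (?tail k))) \<longlonglongrightarrow> 0"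
  proof (rule LIMSEQ_I)
    fix r :: real assume "0 < r"
    then have "0 < r / 4"
      by simp
    then obtain m N where mN: "\<And>k. k \<ge> N \<Longrightarrow> norm (comb (?tail k) (x m) - \<phi> (comb (?tail k))) \<le> 2 * (r / 4)"
      using uniformly_small_tails[of x \<phi>, OF lim] by blast
    have "(\<lambda>k. comb (?tail k) (x m)) \<longlonglongrightarrow> comb (\<lambda>_. 0) (x m)"
      by (rule comb_agree_tendsto_cball[OF ball(3) ball(1)]) (simp add: agree_below_def)
    moreover have "comb (\<lambda>_. 0) (x m) = 0"
      by (simp add: comb_apply)
    ultimately have "(\<lambda>k. comb (?tail k) (x m)) \<longlonglongrightarrow> 0"
      by simp
    from LIMSEQ_D[OF this \<open>0 < r / 4\<close>]
    obtain N' where N': "\<And>k. k \<ge> N' \<Longrightarrow> norm (comb (?tail k) (x m)) < r / 4"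
      by auto
    have "norm (\<phi> (comb (?tail k)) - 0) < r" if "k \<ge> max N N'" for k
    proof -
      have "norm (\<phi> (comb (?tail k))) \<le> norm (comb (?tail k) (x m)) + norm (comb (?tail k) (x m) - \<phi> (comb (?tail k)))"
        using norm_triangle_ineq4[of "comb (?tail k) (x m)" "comb (?tail k) (x m) - \<phi> (comb (?tail k))"] by simp
      also have "\<dots> < r"
        using mN[of k] N'[of k] that \<open>0 < r\<close> by auto
      finally show ?thesis
        by simp
    qed
    then show "\<exists>no. \<forall>n\<ge>no. norm (\<phi> (comb (?tail n)) - 0) < r"
      by blast
  qed
  then have "(\<lambda>k. \<phi> all_one - \<phi> (comb (?tail k))) \<longlonglongrightarrow> \<phi> all_one - 0"
    by (intro tendsto_diff tendsto_const)
  moreover have "\<phi> all_one - \<phi> (comb (?tail k)) = \<phi> (comb (?head k))" for k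
  proof -
    have "all_one = comb (\<lambda>i. ?head k i + ?tail k i)"
      unfolding all_one_def by (rule arg_cong[where f = comb]) auto
    also have "\<dots> = comb (?head k) + comb (?tail k)"
      by (rule comb_add[OF bd(2) bd(1)])
    finally have "\<phi> all_one = \<phi> (comb (?head k)) + \<phi> (comb (?tail k))"
      using assms comb_dual[OF bd(1)] comb_dual[OF bd(2)] by (simp add: baire_one_def bidual_space_def)
    then show ?thesis
      by simp
  qed
  ultimately show ?thesis
    by simp
qed

lemma all_one_dual: "all_one \<in> dual_space smul"
  unfolding all_one_def by (intro comb_dual) simp

lemma c0_copy_psubset_closure:
  "c0_copy \<subset> weak_topology (dual_space smul) (baire_one smul) closure_of c0_copy"
proof -
  have "comb (\<lambda>i. if i < k then 1 else 0) \<in> finite_combs" for k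
    by (rule finite_combsI[of k]) simp
  then have fin: "comb (\<lambda>i. if i < k then 1 else 0) \<in> c0_copy" for k
    using closure_subset by (auto simp: c0_copy_def)
  have "limitin (weak_topology (dual_space smul) (baire_one smul))
      (\<lambda>k. comb (\<lambda>i. if i < k then 1 else 0)) all_one sequentially"
    by (intro limitin_weak_topology all_one_dual baire_one_head_tendsto) (use fin c0_copy_dual in auto)
  then have "all_one \<in> weak_topology (dual_space smul) (baire_one smul) closure_of c0_copy"
    by (rule limitin_in_closure_of) (rule fin)
  moreover have "c0_copy \<subseteq> weak_topology (dual_space smul) (baire_one smul) closure_of c0_copy"
    using c0_copy_dual by (intro closure_of_subset) simp
  ultimately show ?thesis
    using all_one_notin_c0_copy by blast
qed

end

context ell1_quotient
begin

section \<open>Covers of large convex sets\<close>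

text \<open>
  At each index exactly one of the \<open>m\<close> sequences has the entry \<open>p i\<close> and the others have \<open>t\<close>.  It
  matters that \<open>\<beta>\<close> and \<open>m\<close> disappear from the first summand on the right.
\<close>

lemma sum_comb_partition:
  assumes "bounded (range p)" "0 < m"
  shows "(\<Sum>j<m. comb (\<lambda>i. if \<beta> i mod m = j then p i else t)) =
    comb (\<lambda>i. p i - t) + real m *\<^sub>R comb (\<lambda>_. t)"
proof (rule blinfun_eqI)
  fix x
  let ?b = "\<lambda>j i. if \<beta> i mod m = j then p i else t"
  have t: "bounded (range (\<lambda>_::nat. t))"
    by simp
  have "range (?b j) \<subseteq> range p \<union> {t}" for j
    by auto
  then have b: "bounded (range (?b j))" for j
    using bounded_subset[of "range p \<union> {t}"] assms(1) by simp
  have p: "bounded (range (\<lambda>i. p i - t))"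
    using bounded_minus_comp[OF assms(1) t] .
  have "(\<lambda>i. \<Sum>j<m. ?b j i * g i x) sums (\<Sum>j<m. comb (?b j) x)"
    by (intro sums_sum comb_sums b)
  moreover have "(\<lambda>i. (p i - t) * g i x + real m *\<^sub>R (t * g i x)) sums (comb (\<lambda>i. p i - t) x + real m *\<^sub>R comb (\<lambda>_. t) x)"
    by (intro sums_add sums_scaleR_right comb_sums p t)
  moreover have "(\<Sum>j<m. ?b j i * g i x) = (p i - t) * g i x + real m *\<^sub>R (t * g i x)" for i
  proof -
    have "(\<Sum>j<m. ?b j i) = (\<Sum>j<m. (if j = \<beta> i mod m then p i - t else 0) + t)"
      by (rule sum.cong) auto
    also have "\<dots> = p i - t + of_nat m * t"
      using \<open>0 < m\<close> by (simp add: sum.distrib)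
    finally show ?thesis
      by (simp add: sum_distrib_right[symmetric] distrib_right scaleR_conv_of_real mult.assoc)
  qed
  ultimately show "(\<Sum>j<m. comb (?b j)) x = (comb (\<lambda>i. p i - t) + real m *\<^sub>R comb (\<lambda>_. t)) x"
    by (simp add: blinfun.sum_left blinfun.add_left blinfun.scaleR_left sums_unique2)
qed

lemma comb_const: "comb (\<lambda>_. of_real r) = r *\<^sub>R all_one"
  using comb_scale[of "\<lambda>_. 1" "of_real r"] by (simp add: all_one_def dual_scale_of_real)

text \<open>
  If no cylinder exists, \<open>block_pattern\<close> provides points outside \<open>C\<close> whose averages, by
  \<open>sum_comb_partition\<close> and convexity of the complement, are \<open>-3 all_one + v / m\<close> for every \<open>m\<close>.
  A further average with \<open>all_one\<close>, also outside \<open>C\<close>, cancels the first term, and the resulting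
  multiples of the fixed vector \<open>v\<close> are in \<open>C\<close> for large \<open>m\<close>.
\<close>

lemma cover_contains_cylinder:
  assumes "convex C" "convex (- C)" "all_one \<notin> C"
    and absorbing: "\<And>f. f \<in> dual_space smul \<Longrightarrow> \<exists>\<delta>>0. \<forall>s. 0 < s \<longrightarrow> s < \<delta> \<longrightarrow> s *\<^sub>R f \<in> C"
    and cover: "C \<inter> dual_space smul \<subseteq> (\<Union>n::nat. A n)" and A_dual: "\<And>n. A n \<subseteq> dual_space smul"
  shows "\<exists>n b N. range b \<subseteq> cball 0 3 \<and> (\<forall>b'. range b' \<subseteq> cball 0 3 \<longrightarrow> agree_below N b b' \<longrightarrow>
    comb b' \<in> weak_star_dual smul closure_of A n)"
proof (rule ccontr)
  assume no: "\<not> ?thesis"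
  let ?K = "cball 0 3 :: 'k set"
  let ?t = "of_real (- 3) :: 'k"
  define F where "F n = {b. comb b \<in> weak_star_dual smul closure_of A n}" for n
  have "\<exists>p N. range p \<subseteq> ?K \<and> strict_mono N \<and>
    (\<forall>E. (\<exists>\<^sub>\<infinity>k. {N k..<N (Suc k)} \<subseteq> E) \<longrightarrow> (\<forall>n. (\<lambda>i. if i \<in> E then p i else ?t) \<notin> F n))"
  proof (rule block_pattern)
    show "\<exists>N. \<forall>b'. range b' \<subseteq> ?K \<longrightarrow> agree_below N b b' \<longrightarrow> b' \<notin> F n"
      if b: "range b \<subseteq> ?K" "b \<notin> F n" for b n
    proof (rule avoids_closed_under_agreement[OF _ b])
      fix b :: "nat \<Rightarrow> 'k" and b'
      assume *: "range b \<subseteq> ?K" "\<And>N. range (b' N) \<subseteq> ?K" "\<And>N. agree_below N b (b' N)" "\<And>N. b' N \<in> F n"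
      have "limitin (weak_star_dual smul) (\<lambda>N. comb (b' N)) (comb b) sequentially"
        unfolding weak_star_dual_def
        by (rule limitin_weak_topology)
          (use comb_agree_tendsto_cball[OF *(1-3)] in \<open>auto intro!: comb_dual bounded_range_cball[OF *(1)] bounded_range_cball[OF *(2)]\<close>)
      then have "comb b \<in> weak_star_dual smul closure_of (weak_star_dual smul closure_of A n)"
        by (rule limitin_in_closure_of) (use *(4) in \<open>simp add: F_def\<close>)
      then show "b \<in> F n"
        by (simp add: F_def)
    qed
    show "\<exists>b'. range b' \<subseteq> ?K \<and> agree_below N b b' \<and> b' \<notin> F n" if "range b \<subseteq> ?K" for n b N
      using no that unfolding F_def by blast
  qed simp
  then obtain p and N :: "nat \<Rightarrow> nat" where p: "range p \<subseteq> ?K" and N: "strict_mono N"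
    and pattern: "\<forall>E. (\<exists>\<^sub>\<infinity>k. {N k..<N (Suc k)} \<subseteq> E) \<longrightarrow> (\<forall>n. (\<lambda>i. if i \<in> E then p i else ?t) \<notin> F n)"
    by (elim exE conjE)
  \<comment> \<open>This is \<open>k\<close> on the \<open>k\<close>-th block; indices before \<open>N 0\<close> are assigned to block 0, so that the residue classes partition all.\<close>
  define block where "block i = (LEAST k. i < N (Suc k))" for i
  have block: "block i = k" if "i \<in> {N k..<N (Suc k)}" for i k
    unfolding block_def
  proof (rule Least_equality)
    fix l assume "i < N (Suc l)"
    then have "N k < N (Suc l)"
      using that by simp
    then show "k \<le> l"
      using strict_mono_less[OF N, of k "Suc l"] by simp
  qed (use that in simp)
  have outside: "comb (\<lambda>i. if block i mod m = j then p i else ?t) \<in> - C" if "j < m" for m j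
  proof
    let ?b = "\<lambda>i. if block i mod m = j then p i else ?t"
    assume "comb ?b \<in> C"
    have "\<exists>\<^sub>\<infinity>k. {N k..<N (Suc k)} \<subseteq> {i. block i mod m = j}"
      unfolding INFM_nat_le
    proof
      fix l
      have "l \<le> l * m"
        using \<open>j < m\<close> mult_le_mono2[of 1 m l] by simp
      then have "l \<le> l * m + j"
        by linarith
      moreover have "(l * m + j) mod m = j"
        using \<open>j < m\<close> by simp
      ultimately show "\<exists>k\<ge>l. {N k..<N (Suc k)} \<subseteq> {i. block i mod m = j}"
        using block by (intro exI[of _ "l * m + j"]) auto
    qed
    from pattern[rule_format, OF this] have "?b \<notin> F n" for n
      by simp
    moreover have "range ?b \<subseteq> ?K"
      using p by auto
    then have "comb ?b \<in> dual_space smul"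
      by (intro comb_dual bounded_range_cball)
    then obtain n where "comb ?b \<in> A n"
      using cover \<open>comb ?b \<in> C\<close> by blast
    then have "?b \<in> F n"
      using closure_of_subset[of "A n" "weak_star_dual smul"] A_dual[of n]
      by (auto simp: F_def weak_star_dual_def)
    ultimately show False
      by blast
  qed
  define v where "v = comb (\<lambda>i. p i - ?t)"
  have "bounded (range (\<lambda>i. p i - ?t))"
    by (intro bounded_minus_comp bounded_range_cball[OF p]) simp
  then have "v \<in> dual_space smul"
    unfolding v_def by (rule comb_dual)
  then obtain \<delta> where \<delta>: "0 < \<delta>" "\<And>s. 0 < s \<Longrightarrow> s < \<delta> \<Longrightarrow> s *\<^sub>R v \<in> C"
    using absorbing by blast
  obtain m where m: "1 / \<delta> < real m" "0 < m"
  proof -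
    obtain m where "1 / \<delta> < real m"
      using reals_Archimedean2 by blast
    moreover have "0 < 1 / \<delta>"
      using \<delta>(1) by simp
    ultimately have "0 < real m"
      by linarith
    with \<open>1 / \<delta> < real m\<close> show thesis
      using that[of m] by simp
  qed
  have "(\<Sum>j<m. (1 / real m) *\<^sub>R comb (\<lambda>i. if block i mod m = j then p i else ?t)) \<in> - C"
    using m outside by (intro convex_sum assms(2)) auto
  also have "(\<Sum>j<m. (1 / real m) *\<^sub>R comb (\<lambda>i. if block i mod m = j then p i else ?t)) =
      (1 / real m) *\<^sub>R v - 3 *\<^sub>R all_one"
  proof -
    have "(\<Sum>j<m. (1 / real m) *\<^sub>R comb (\<lambda>i. if block i mod m = j then p i else ?t)) =
        (1 / real m) *\<^sub>R (v + real m *\<^sub>R ((- 3) *\<^sub>R all_one))"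
      using sum_comb_partition[OF bounded_range_cball[OF p] m(2), of block ?t]
      by (simp only: v_def comb_const flip: scaleR_sum_right)
    then show ?thesis
      using m(2) by (simp add: scaleR_right_distrib scaleR_right_diff_distrib)
  qed
  finally have "(1 / 4) *\<^sub>R ((1 / real m) *\<^sub>R v - 3 *\<^sub>R all_one) + (3 / 4) *\<^sub>R all_one \<in> - C"
    using assms(2,3) by (intro convexD) auto
  moreover have "(1 / 4) *\<^sub>R ((1 / real m) *\<^sub>R v - 3 *\<^sub>R all_one) + (3 / 4) *\<^sub>R all_one = (1 / (4 * real m)) *\<^sub>R v"
    by (simp add: scaleR_right_diff_distrib)
  moreover have "1 / (4 * real m) < \<delta>"
  proof -
    have "1 < real m * \<delta>"
      using m(1) \<delta>(1) by (simp add: field_simps)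
    then have "1 < 4 * real m * \<delta>"
      by linarith
    then show ?thesis
      using m(2) by (simp add: field_simps)
  qed
  ultimately show False
    using \<delta>(2)[of "1 / (4 * real m)"] m(2) by simp
qed

text \<open>
  A cylinder in the ball of radius 3 contains a sequence that is eventually 3.  Its image differs from
  \<open>3 all_one\<close> by some \<open>y\<close> in the subspace \<open>c0_copy\<close>, and because \<open>3 > 2\<close>, the point
  \<open>2 all_one\<close> divides a segment from that image to a multiple of \<open>y\<close>.
\<close>

lemma twice_all_one_in_I_envelope:
  assumes C: "convex C" "convex (- C)" "all_one \<notin> C" "c0_copy \<subseteq> C"
    and absorbing: "\<And>f. f \<in> dual_space smul \<Longrightarrow> \<exists>\<delta>>0. \<forall>s. 0 < s \<longrightarrow> s < \<delta> \<longrightarrow> s *\<^sub>R f \<in> C"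
  shows "2 *\<^sub>R all_one \<in> I_envelope smul (C \<inter> dual_space smul)"
  unfolding I_envelope_def
proof clarify
  fix A :: "nat \<Rightarrow> _" assume A: "C \<inter> dual_space smul = (\<Union>n. A n)"
  let ?cl = "\<lambda>n. weak_star_dual smul closure_of (convex hull (A n))"
  have hull_dual: "convex hull (A n) \<subseteq> dual_space smul" for n
    using A by (intro hull_minimal convex_dual_space) auto
  have A_cl: "A n \<subseteq> ?cl n" for n
    using closure_of_subset[of "convex hull (A n)" "weak_star_dual smul"] hull_dual[of n] hull_subset[of "A n" convex]
    by (auto simp: weak_star_dual_def)
  have "C \<inter> dual_space smul \<subseteq> (\<Union>n. convex hull (A n))"
    using A hull_subset[of _ convex] by blast
  from cover_contains_cylinder[OF C(1-3) absorbing this hull_dual]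
  obtain n b N where b: "range b \<subseteq> cball 0 3"
    and cyl: "\<And>b'. range b' \<subseteq> cball 0 3 \<Longrightarrow> agree_below N b b' \<Longrightarrow> comb b' \<in> ?cl n"
    by blast
  define y where "y = comb (\<lambda>i. if i < N then b i - 3 else 0)"
  have "y \<in> finite_combs"
    unfolding y_def by (rule finite_combsI[of N]) simp
  then have "(- 2) *\<^sub>R y \<in> c0_copy"
    using closure_subset by (intro c0_copy_scaleR) (auto simp: c0_copy_def)
  then have "(- 2) *\<^sub>R y \<in> (\<Union>n. A n)"
    using C(4) c0_copy_dual A by blast
  then have 1: "(- 2) *\<^sub>R y \<in> (\<Union>n. ?cl n)"
    using A_cl by blast
  have "comb (\<lambda>i. if i < N then b i else 3) \<in> ?cl n"
    using b by (intro cyl) (auto simp: agree_below_def)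
  also have "comb (\<lambda>i. if i < N then b i else 3) = y + 3 *\<^sub>R all_one"
  proof -
    have "(\<lambda>i. if i < N then b i else 3) = (\<lambda>i. (if i < N then b i - 3 else 0) + of_real 3)"
      by auto
    then show ?thesis
      using comb_add[of "\<lambda>i. if i < N then b i - 3 else 0" "\<lambda>_. of_real 3"]
        bounded_range_eventually_const[of N "\<lambda>i. if i < N then b i - 3 else 0" 0]
      by (simp add: y_def comb_const[of 3] del: of_real_numeral)
  qed
  finally have 2: "y + 3 *\<^sub>R all_one \<in> (\<Union>n. ?cl n)"
    by blast
  have "(1 / 3) *\<^sub>R ((- 2) *\<^sub>R y) + (2 / 3) *\<^sub>R (y + 3 *\<^sub>R all_one) \<in> convex hull (\<Union>n. ?cl n)"
    using hull_inc[OF 1, of convex] hull_inc[OF 2, of convex] by (intro convexD convex_convex_hull) auto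
  also have "(1 / 3) *\<^sub>R ((- 2) *\<^sub>R y) + (2 / 3) *\<^sub>R (y + 3 *\<^sub>R all_one) = 2 *\<^sub>R all_one"
    by (simp add: scaleR_right_distrib flip: scaleR_left_distrib)
  finally show "2 *\<^sub>R all_one \<in> closure (convex hull (\<Union>n. ?cl n))"
    using closure_subset by blast
qed

end

section \<open>Locally convex topologies\<close>

lemma openin_affine_preimage:
  assumes "locally_convex_topology_on_dual smul \<tau>" "openin \<tau> U" "a \<in> dual_space smul"
  shows "openin \<tau> {f \<in> dual_space smul. a + dual_scale c f \<in> U}"
proof -
  have top: "topspace \<tau> = dual_space smul"
    and add: "continuous_map (prod_topology \<tau> \<tau>) \<tau> (\<lambda>(f, g). f + g)"
    and scale: "continuous_map (prod_topology euclidean \<tau>) \<tau> (\<lambda>(c, f). dual_scale c f)"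
    using assms(1) by (simp_all add: locally_convex_topology_on_dual_def)
  have "continuous_map \<tau> (prod_topology euclidean \<tau>) (\<lambda>f. (c, f))"
    by (intro continuous_map_pairedI) simp_all
  from continuous_map_compose[OF this scale] have "continuous_map \<tau> \<tau> (dual_scale c)"
    by (simp add: o_def)
  then have "continuous_map \<tau> (prod_topology \<tau> \<tau>) (\<lambda>f. (a, dual_scale c f))"
    using assms(3) top by (intro continuous_map_pairedI) simp_all
  from continuous_map_compose[OF this add] have "continuous_map \<tau> \<tau> (\<lambda>f. a + dual_scale c f)"
    by (simp add: o_def)
  from openin_continuous_map_preimage[OF this assms(2)] show ?thesis
    by (simp add: top)
qed

lemma neighbourhood_of_zero_absorbing:
  fixes smul :: "'k::{real_normed_field,banach} \<Rightarrow> 'a::banach \<Rightarrow> 'a"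
  assumes "locally_convex_topology_on_dual smul \<tau>" "openin \<tau> U" "0 \<in> U" "f \<in> dual_space smul"
  shows "\<exists>\<delta>>0. \<forall>s. 0 < s \<longrightarrow> s < \<delta> \<longrightarrow> s *\<^sub>R f \<in> U"
proof -
  have top: "topspace \<tau> = dual_space smul"
    and scale: "continuous_map (prod_topology euclidean \<tau>) \<tau> (\<lambda>(c, f). dual_scale c f)"
    using assms(1) by (simp_all add: locally_convex_topology_on_dual_def)
  have "continuous_map euclidean (prod_topology euclidean \<tau>) (\<lambda>s. (of_real s :: 'k, f))"
    using assms(4) top by (intro continuous_map_pairedI) (simp_all add: linear_continuous_on bounded_linear_of_real)
  from continuous_map_compose[OF this scale] have "continuous_map euclidean \<tau> (\<lambda>s. s *\<^sub>R f)"
    by (simp add: o_def dual_scale_of_real)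
  from openin_continuous_map_preimage[OF this assms(2)] have "open {s. s *\<^sub>R f \<in> U}"
    by simp
  moreover have "0 \<in> {s. s *\<^sub>R f \<in> U}"
    using assms(3) by simp
  ultimately obtain \<delta> where "0 < \<delta>" "ball 0 \<delta> \<subseteq> {s. s *\<^sub>R f \<in> U}"
    using open_contains_ball by meson
  then show ?thesis
    by (intro exI[of _ \<delta>]) (auto simp: subset_iff)
qed

context ell1_quotient
begin

text \<open>
  The set \<open>C\<close> is obtained from a convex neighbourhood of \<open>c0_copy\<close> that misses \<open>all_one\<close>.  The point
  \<open>2 all_one\<close> is outside its \<open>\<tau>\<close>-closure: if \<open>f\<close> is \<open>\<tau>\<close>-close to \<open>2 all_one\<close>, then
  \<open>2 all_one - f\<close> is in \<open>C\<close>, and \<open>f \<in> C\<close> would put the midpoint \<open>all_one\<close> into \<open>C\<close>.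
\<close>

lemma I_envelope_not_locally_convex_closure:
  assumes \<tau>: "locally_convex_topology_on_dual smul \<tau>"
    and env: "\<And>A. A \<subseteq> dual_space smul \<Longrightarrow> I_envelope smul A = \<tau> closure_of (convex hull A)"
  shows False
proof -
  have top: "topspace \<tau> = dual_space smul"
    using \<tau> by (simp add: locally_convex_topology_on_dual_def)
  obtain D where "countable D" "D \<noteq> {}" "D \<subseteq> c0_copy" "c0_copy \<subseteq> closure D"
    using c0_copy_has_countable_dense_subset by blast
  then have "I_envelope smul c0_copy \<subseteq> closure c0_copy"
    by (intro I_envelope_subset_closure convex_c0_copy)
  then have "I_envelope smul c0_copy \<subseteq> c0_copy"
    by (simp add: c0_copy_def)
  then have "all_one \<notin> \<tau> closure_of c0_copy"
    using all_one_notin_c0_copy env[OF c0_copy_dual] hull_same[of convex, OF convex_c0_copy] by auto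
  then obtain U where U: "openin \<tau> U" "all_one \<in> U" "U \<inter> c0_copy = {}"
    using all_one_dual top by (auto simp: in_closure_of)
  \<comment> \<open>The reflection of \<open>U\<close> through \<open>all_one\<close> makes it a neighbourhood of 0.\<close>
  define U' where "U' = {f \<in> dual_space smul. all_one + dual_scale (- 1) f \<in> U}"
  have minus: "all_one + dual_scale (- 1) f = all_one - f" for f
    using dual_scale_of_real[of "- 1" f] by simp
  have "openin \<tau> U'"
    unfolding U'_def by (rule openin_affine_preimage[OF \<tau> U(1) all_one_dual])
  moreover have "0 \<in> U'"
    using U(2) zero_in_dual_space by (simp add: U'_def minus)
  ultimately obtain V V0 where V: "convex V" "openin \<tau> V0" "0 \<in> V0" "V0 \<subseteq> V" "V \<subseteq> U'"
    using \<tau> unfolding locally_convex_topology_on_dual_def by meson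
  define W where "W = (\<Union>y\<in>c0_copy. \<Union>v\<in>V. {y + v})"
  have "convex W"
    unfolding W_def by (intro convex_sums convex_c0_copy V)
  have "0 \<in> c0_copy"
    using subspace_c0_copy unfolding module.subspace_def[OF module_dual_scale] by blast
  have "all_one \<notin> W"
  proof
    assume "all_one \<in> W"
    then obtain y v where "y \<in> c0_copy" "v \<in> V" "all_one = y + v"
      unfolding W_def by blast
    have "all_one - v \<in> U"
      using V(5) \<open>v \<in> V\<close> by (auto simp: U'_def minus simp del: diff_conv_add_uminus)
    then have "y \<in> U"
      using \<open>all_one = y + v\<close> by simp
    with \<open>y \<in> c0_copy\<close> U(3) show False
      by blast
  qed
  have "c0_copy \<subseteq> W"
  proof
    fix y assume "y \<in> c0_copy"
    moreover have "0 \<in> V"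
      using V by blast
    moreover have "y = y + 0"
      by simp
    ultimately show "y \<in> W"
      unfolding W_def by blast
  qed
  have "V0 \<subseteq> W"
  proof
    fix v assume "v \<in> V0"
    then have "v \<in> V" "v = 0 + v"
      using V by auto
    with \<open>0 \<in> c0_copy\<close> show "v \<in> W"
      unfolding W_def by blast
  qed
  obtain C where C: "W \<subseteq> C" "convex C" "convex (- C)" "all_one \<notin> C"
    using maximal_convex_avoiding[of W all_one] \<open>convex W\<close> \<open>all_one \<notin> W\<close> \<open>c0_copy \<subseteq> W\<close> \<open>0 \<in> c0_copy\<close> by blast
  have "2 *\<^sub>R all_one \<in> I_envelope smul (C \<inter> dual_space smul)"
  proof (rule twice_all_one_in_I_envelope)
    show "\<exists>\<delta>>0. \<forall>s. 0 < s \<longrightarrow> s < \<delta> \<longrightarrow> s *\<^sub>R f \<in> C" if "f \<in> dual_space smul" for f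
      using neighbourhood_of_zero_absorbing[OF \<tau> V(2,3) that] \<open>V0 \<subseteq> W\<close> C(1) by blast
  qed (use C \<open>c0_copy \<subseteq> W\<close> in auto)
  moreover have "convex hull (C \<inter> dual_space smul) = C \<inter> dual_space smul"
    by (intro hull_same convex_Int C convex_dual_space)
  ultimately have in_closure: "2 *\<^sub>R all_one \<in> \<tau> closure_of (C \<inter> dual_space smul)"
    using env[of "C \<inter> dual_space smul"] by simp
  have reflected_open: "openin \<tau> {f \<in> dual_space smul. 2 *\<^sub>R all_one + dual_scale (- 1) f \<in> V0}"
    by (intro openin_affine_preimage[OF \<tau> V(2)] dual_space_scaleR[OF all_one_dual])
  have "2 *\<^sub>R all_one \<in> {f \<in> dual_space smul. 2 *\<^sub>R all_one + dual_scale (- 1) f \<in> V0}"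
    using V(3) dual_space_scaleR[OF all_one_dual] dual_scale_of_real[of "- 1" "2 *\<^sub>R all_one"] by simp
  with in_closure reflected_open
  have "\<exists>f. f \<in> C \<inter> dual_space smul \<and> f \<in> {f \<in> dual_space smul. 2 *\<^sub>R all_one + dual_scale (- 1) f \<in> V0}"
    by (simp only: in_closure_of)
  then obtain f where f: "f \<in> C" "2 *\<^sub>R all_one + dual_scale (- 1) f \<in> V0"
    by blast
  have reflected: "2 *\<^sub>R all_one - f \<in> C"
    using f(2) \<open>V0 \<subseteq> W\<close> C(1) dual_scale_of_real[of "- 1" f] by auto
  have "(1 / 2) *\<^sub>R f + (1 / 2) *\<^sub>R (2 *\<^sub>R all_one - f) \<in> C"
    by (rule convexD[OF C(2) f(1) reflected]) simp_all
  moreover have "(1 / 2) *\<^sub>R f + (1 / 2) *\<^sub>R (2 *\<^sub>R all_one - f) = all_one"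
    by (simp add: scaleR_right_diff_distrib)
  ultimately show False
    using C(4) by simp
qed

end

section \<open>Complemented copies of \<open>\<ell>\<^sup>1\<close>\<close>

lemma ell1_quotient_of_complemented_ell1:
  fixes smul :: "'k::{real_normed_field,banach} \<Rightarrow> 'a::banach \<Rightarrow> 'a"
  assumes "banach_over smul" "contains_complemented_ell1 smul"
  shows "\<exists>g u B M. ell1_quotient smul g u B M"
proof -
  interpret banach_over smul
    by fact
  obtain E J P where "closed E" and P_scale: "\<And>c x. blinfun_apply P (smul c x) = smul c (blinfun_apply P x)"
    and range_P: "range (blinfun_apply P) = E" and P_E: "\<And>x. x \<in> E \<Longrightarrow> blinfun_apply P x = x"
    and J: "ell1_isomorphism_onto smul E J"
    using assms(2) unfolding contains_complemented_ell1_def complemented_subspace_def by metis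
  have bij: "bij_betw J ell1 E"
    and J_add: "\<And>a b. a \<in> ell1 \<Longrightarrow> b \<in> ell1 \<Longrightarrow> J (\<lambda>n. a n + b n) = J a + J b"
    and J_scale: "\<And>c a. a \<in> ell1 \<Longrightarrow> J (\<lambda>n. c * a n) = smul c (J a)"
    using J by (auto simp: ell1_isomorphism_onto_def)
  obtain m M where "0 < m" and lower: "\<And>a. a \<in> ell1 \<Longrightarrow> m * ell1_norm a \<le> norm (J a)"
    and upper: "\<And>a. a \<in> ell1 \<Longrightarrow> norm (J a) \<le> M * ell1_norm a"
    using J unfolding ell1_isomorphism_onto_def by metis
  define q where "q x = inv_into ell1 J (blinfun_apply P x)" for x
  have q_ell1: "q x \<in> ell1" and J_q: "J (q x) = blinfun_apply P x" for x
    using bij range_P by (auto simp: q_def bij_betw_def inv_into_into f_inv_into_f)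
  have qI: "q x = a" if "a \<in> ell1" "J a = blinfun_apply P x" for x a
    using bij that by (auto simp: q_def bij_betw_def inv_into_f_eq)
  have ell1_add: "(\<lambda>n. a n + b n) \<in> ell1" if "a \<in> ell1" "b \<in> ell1" for a b :: "nat \<Rightarrow> 'k"
  proof -
    have "summable (\<lambda>n. norm (a n) + norm (b n))"
      using that by (intro summable_add) (simp_all add: ell1_def)
    then show ?thesis
      unfolding ell1_def mem_Collect_eq
      by (rule summable_comparison_test'[where N = 0]) (simp add: norm_triangle_ineq)
  qed
  have ell1_scale: "(\<lambda>n. c * a n) \<in> ell1" if "a \<in> ell1" for c and a :: "nat \<Rightarrow> 'k"
    using that by (auto simp: ell1_def norm_mult)
  have q_add: "q (x + y) = (\<lambda>n. q x n + q y n)" for x y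
    by (intro qI ell1_add q_ell1) (simp add: J_add q_ell1 J_q blinfun.add_right)
  have q_scale: "q (smul c x) = (\<lambda>n. c * q x n)" for c x
    by (intro qI ell1_scale q_ell1) (simp add: J_scale q_ell1 J_q P_scale)
  have q_norm: "ell1_norm (q x) \<le> norm P / m * norm x" for x
  proof -
    have "m * ell1_norm (q x) \<le> norm P * norm x"
      using lower[OF q_ell1[of x]] norm_blinfun[of P x] by (simp add: J_q)
    then show ?thesis
      using \<open>0 < m\<close> by (simp add: field_simps)
  qed
  have summable_q: "summable (\<lambda>i. norm (q x i))" for x
    using q_ell1[of x] by (simp add: ell1_def)
  have q_le: "norm (q x i) \<le> ell1_norm (q x)" for x i
    using sum_le_suminf[OF summable_q[of x], of "{i}"] by (simp add: ell1_norm_def)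
  have linear: "bounded_linear (\<lambda>x. q x i)" for i
  proof (rule bounded_linear_intro[of _ "norm P / m"])
    show "q (r *\<^sub>R x) i = r *\<^sub>R q x i" for r x
      using q_scale[of "of_real r" x] by (simp add: scale_of_real scaleR_conv_of_real)
    show "norm (q x i) \<le> norm x * (norm P / m)" for x
      using q_le[of x i] q_norm[of x] by (simp add: mult.commute)
  qed (simp add: q_add)
  define g where "g i = Blinfun (\<lambda>x. q x i)" for i
  have g: "blinfun_apply (g i) x = q x i" for i x
    by (simp add: g_def bounded_linear_Blinfun_apply linear)
  define \<delta> where "\<delta> j = (\<lambda>i. if i = j then 1 else 0 :: 'k)" for j :: nat
  have norm_\<delta>: "(\<lambda>i. norm (\<delta> j i)) sums 1" for j
    using sums_single[of j "\<lambda>_. 1 :: real"] by (simp add: \<delta>_def if_distrib cong: if_cong)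
  then have \<delta>_ell1: "\<delta> j \<in> ell1" and \<delta>_norm: "ell1_norm (\<delta> j) = 1" for j
    by (auto simp: ell1_def ell1_norm_def intro: sums_summable sums_unique[symmetric])
  define u where "u j = J (\<delta> j)" for j
  have q_u: "q (u j) = \<delta> j" for j
  proof (rule qI[OF \<delta>_ell1])
    have "u j \<in> E"
      unfolding u_def using bij \<delta>_ell1 by (auto simp: bij_betw_def)
    then show "J (\<delta> j) = blinfun_apply P (u j)"
      by (simp add: P_E u_def)
  qed
  have "ell1_quotient smul g u (norm P / m) M"
  proof
    show "g i \<in> dual_space smul" for i
      by (simp add: dual_space_def g q_scale)
    show "summable (\<lambda>i. norm (g i x))" for x
      by (simp add: g summable_q)
    show "(\<Sum>i. norm (g i x)) \<le> norm P / m * norm x" for x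
      using q_norm[of x] by (simp add: g ell1_norm_def)
    show "g i (u j) = (if i = j then 1 else 0)" for i j
      by (simp add: g q_u \<delta>_def)
    show "norm (u i) \<le> M" for i
      using upper[OF \<delta>_ell1[of i]] by (simp add: u_def \<delta>_norm)
  qed
  then show ?thesis
    by blast
qed

theorem proposition3p7:
  fixes smul :: "'k::{real_normed_field,banach} \<Rightarrow> 'a::banach \<Rightarrow> 'a"
  assumes "banach_over smul"
    and "contains_complemented_ell1 smul"
  shows "(\<exists>Y \<subseteq> dual_space smul.
            module.subspace dual_scale Y \<and> closed Y \<and> separable_space (top_of_set Y) \<and>
            Y \<subset> weak_topology (dual_space smul) (baire_one smul) closure_of Y) \<and>
         \<not> (\<exists>\<tau>. locally_convex_topology_on_dual smul \<tau> \<and>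
               (\<forall>A \<subseteq> dual_space smul. I_envelope smul A = \<tau> closure_of (convex hull A)))"
proof -
  obtain g u B M where "ell1_quotient smul g u B M"
    using ell1_quotient_of_complemented_ell1[OF assms] by blast
  then interpret ell1_quotient smul g u B M .
  have "closed c0_copy"
    by (simp add: c0_copy_def)
  then show ?thesis
    using c0_copy_dual subspace_c0_copy separable_c0_copy c0_copy_psubset_closure I_envelope_not_locally_convex_closure
    by blast
qed

end
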